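(* Let $n\in\mathbb{N}_+$ and let $\lambda,\mu$ be partitions. If $\langle s_\mu,\ p_n\circ s_\lambda\rangle\neq 0$, then $[\lambda]\subseteq[\mu]$, i.e. $\lambda_i\le\mu_i$ for all $i$.
   Context: $p_n$ is the $n$-th power sum symmetric function, $\circ$ denotes plethysm, so that $p_n\circ s_\lambda=s_\lambda(x_1^n,x_2^n,\dots)$, and $\langle\cdot,\cdot\rangle$ is the Hall inner product on symmetric functions, for which the Schur functions are orthonormal. For a partition $\lambda$, its diagram is $[\lambda]=\{(j,i)\in\mathbb{N}_0^2:0\le j<\lambda_{i+1}\}$. *)

theory Defs
  imports Main
begin

definition is_partition :: "nat list \<Rightarrow> bool" where
  "is_partition lam \<longleftrightarrow> sorted_wrt (\<ge>) lam \<and> 0 \<notin> set lam"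

definition part :: "nat list \<Rightarrow> nat \<Rightarrow> nat" where
  "part lam i = (if i < length lam then lam ! i else 0)"

definition diagram :: "nat list \<Rightarrow> (nat \<times> nat) set" where
  "diagram lam = {(j, i). j < part lam i}"

(* Symmetric functions in the variables x_0, x_1, ... are represented by their
   coefficient functions: monomial x^alpha (alpha finitely supported) \<mapsto> coefficient. *)
type_synonym symfun = "(nat \<Rightarrow> nat) \<Rightarrow> int"

(* Semistandard Young tableau of shape lam: T i j is the entry in row i, column j
   (entries are variable indices in nat); T is 0 outside the diagram. *)
definition ssyt :: "nat list \<Rightarrow> (nat \<Rightarrow> nat \<Rightarrow> nat) \<Rightarrow> bool" where
  "ssyt lam T \<longleftrightarrow>
     (\<forall>i j. \<not> j < part lam i \<longrightarrow> T i j = 0) \<and>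
     (\<forall>i j j'. j \<le> j' \<and> j' < part lam i \<longrightarrow> T i j \<le> T i j') \<and>
     (\<forall>i i' j. i < i' \<and> j < part lam i' \<longrightarrow> T i j < T i' j)"

definition content :: "nat list \<Rightarrow> (nat \<Rightarrow> nat \<Rightarrow> nat) \<Rightarrow> nat \<Rightarrow> nat" where
  "content lam T k = card {(i, j). j < part lam i \<and> T i j = k}"

definition kostka :: "nat list \<Rightarrow> (nat \<Rightarrow> nat) \<Rightarrow> nat" where
  "kostka lam alpha = card {T. ssyt lam T \<and> content lam T = alpha}"

(* Schur function s_lam = sum over SSYT T of x^T *)
definition schur :: "nat list \<Rightarrow> symfun" where
  "schur lam alpha = int (kostka lam alpha)"

(* Plethysm p_n \<circ> s_lam = s_lam(x_0^n, x_1^n, ...) *)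
definition pleth_pn_schur :: "nat \<Rightarrow> nat list \<Rightarrow> symfun" where
  "pleth_pn_schur n lam beta =
     (if (\<forall>k. n dvd beta k) then schur lam (\<lambda>k. beta k div n) else 0)"

definition schur_expansion :: "symfun \<Rightarrow> (nat list \<Rightarrow> int) \<Rightarrow> bool" where
  "schur_expansion f c \<longleftrightarrow>
     finite {nu. c nu \<noteq> 0} \<and> (\<forall>nu. c nu \<noteq> 0 \<longrightarrow> is_partition nu) \<and>
     (\<forall>alpha. f alpha = (\<Sum>nu\<in>{nu. c nu \<noteq> 0}. c nu * schur nu alpha))"

(* Hall inner product <s_mu, f>: Schur functions are orthonormal, so this is the
   coefficient of s_mu in the Schur expansion of f. *)
definition hall_schur :: "nat list \<Rightarrow> symfun \<Rightarrow> int" where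
  "hall_schur mu f = (THE c. schur_expansion f c) mu"

end

(* Coefficients of Schur functions count chains of horizontal strips. More generally, the pairing
   of s_nu with h_{w_1} h_{w_2} ... e_{a_1} e_{a_2} ... counts chains of horizontal strips followed
   by vertical strips, and it is a signed sum of coefficients, since e_k is the alternating sum of
   the h_a e_{k-a}. If box (j, i) lies in lam, then s_lam pairs to zero with every product of i
   complete and j elementary functions: i horizontal and j vertical strips only build shapes
   inside the hook without that box. As p_n o _ is adjoint to a ring homomorphism h_k |-> h_{k/n},
   e_k |-> +-e_{k/n}, the same vanishing holds for p_n o s_lam. On the other hand, these pairings
   are unitriangular on the Schur functions of shapes not containing box (j, i), so none of these
   occurs in p_n o s_lam. The same triangularity with j = 0, together with the symmetry
   of Schur functions, gives existence and uniqueness of Schur expansions, without which hall_schur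
   would be an unspecified value. *)

theory Submission
  imports Defs
begin

section \<open>Shapes and strips\<close>

definition psize :: "(nat \<Rightarrow> nat) \<Rightarrow> nat" where
  "psize p = (\<Sum>i | p i \<noteq> 0. p i)"

text \<open>Shapes are row-length functions rather than lists, so that inclusion is the pointwise
  order and trailing zeros cause no ambiguity.\<close>

definition par :: "(nat \<Rightarrow> nat) \<Rightarrow> bool" where
  "par p \<longleftrightarrow> antimono p \<and> finite {i. p i \<noteq> 0}"

text \<open>What is left of \<open>q\<close> after removing a strip of \<open>a\<close> boxes. The
  bound \<open>q (Suc i) \<le> p i\<close> keeps any two removed boxes out of a common column, and
  \<open>q i \<le> Suc (p i)\<close> out of a common row.\<close>

definition strips :: "bool \<Rightarrow> nat \<Rightarrow> (nat \<Rightarrow> nat) \<Rightarrow> (nat \<Rightarrow> nat) set" where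
  "strips v a q = {p. antimono p \<and> p \<le> q \<and>
     (if v then \<forall>i. q i \<le> Suc (p i) else \<forall>i. q (Suc i) \<le> p i) \<and> psize q = psize p + a}"

lemma psize_eq_sum: "psize p = sum p A" if "finite A" "{i. p i \<noteq> 0} \<subseteq> A"
  unfolding psize_def using that by (intro sum.mono_neutral_left) auto

lemma le_fun_zero: "p \<le> q \<Longrightarrow> q i = 0 \<Longrightarrow> p i = 0" for p q :: "nat \<Rightarrow> nat"
  by (metis le_funD le_zero_eq)

lemma finite_support_le: "finite {i. p i \<noteq> 0}" if "p \<le> q" "finite {i. q i \<noteq> 0}"
  for p q :: "nat \<Rightarrow> nat"
proof (rule finite_subset[OF _ that(2)])
  show "{i. p i \<noteq> 0} \<subseteq> {i. q i \<noteq> 0}"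
    using that(1) unfolding le_fun_def by (auto intro: less_le_trans)
qed

lemma par_le: "par p" if "antimono p" "p \<le> q" "par q"
  using that finite_support_le unfolding par_def by blast

lemma par_bound:
  assumes "par p"
  obtains R where "\<And>i. i \<ge> R \<Longrightarrow> p i = 0"
proof -
  have "finite {i. p i \<noteq> 0}" using assms by (simp add: par_def)
  then obtain R where R: "\<forall>i\<in>{i. p i \<noteq> 0}. i < R"
    using finite_nat_set_iff_bounded by blast
  show ?thesis by (rule that[of R]) (use R in force)
qed

lemma psize_lessThan: "psize p = (\<Sum>i<R. p i)" if "\<And>i. i \<ge> R \<Longrightarrow> p i = 0"
proof (rule psize_eq_sum)
  show "{i. p i \<noteq> 0} \<subseteq> {..<R}" using that by (metis (mono_tags) lessThan_iff mem_Collect_eq not_le subsetI)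
qed simp

lemma psize_mono: "psize p \<le> psize q" if "p \<le> q" and q: "par q"
proof -
  obtain R where R: "\<And>i. i \<ge> R \<Longrightarrow> q i = 0" using par_bound[OF q] by blast
  have R': "\<And>i. i \<ge> R \<Longrightarrow> p i = 0" using R that(1) le_fun_zero by blast
  show ?thesis using that(1) psize_lessThan[of R q] psize_lessThan[of R p] R R'
    by (auto simp: le_fun_def intro: sum_mono)
qed

lemma psize_le_eq: "p = q" if "p \<le> q" and q: "par q" and "psize p = psize q"
proof (rule ccontr)
  assume "p \<noteq> q"
  then obtain i where "p i \<noteq> q i" by blast
  with le_funD[OF that(1), of i] have i: "p i < q i" by linarith
  obtain R where R: "\<And>i. i \<ge> R \<Longrightarrow> q i = 0" using par_bound[OF q] by blast
  have R': "\<And>i. i \<ge> R \<Longrightarrow> p i = 0" using R that(1) le_fun_zero by blast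
  have "i < R" using R i by (metis not_le not_less_zero)
  then have "(\<Sum>i<R. p i) < (\<Sum>i<R. q i)"
    using that(1) i by (intro sum_strict_mono_ex1) (auto simp: le_fun_def)
  then show False using that(3) psize_lessThan[of R q] psize_lessThan[of R p] R R' by simp
qed

lemma psize_card: "psize p = card {(i, j). j < p i}" "finite {(i, j). j < p i}"
  if "finite {i. p i \<noteq> 0}"
proof -
  have eq: "{(i, j). j < p i} = (SIGMA i:{i. p i \<noteq> 0}. {..<p i})" by auto
  show "psize p = card {(i, j). j < p i}" "finite {(i, j). j < p i}"
    unfolding eq using that by (auto simp: psize_def)
qed

lemma psize_zero: "psize (\<lambda>_. 0) = 0"
  by (simp add: psize_def)

lemma finite_below: "finite {p. p \<le> q}" if q: "par q" for q :: "nat \<Rightarrow> nat"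
proof -
  obtain R where R: "\<And>i. i \<ge> R \<Longrightarrow> q i = 0" using par_bound[OF q] by blast
  have "q i \<le> q 0" for i using q by (simp add: par_def antimono_def)
  then have "{p. p \<le> q} \<subseteq> {p. \<forall>x. (x \<in> {..<R} \<longrightarrow> p x \<in> {..q 0}) \<and> (x \<notin> {..<R} \<longrightarrow> p x = 0)}"
    using R le_fun_zero[of _ q] by (auto simp: not_less dest: le_funD intro: order_trans)
  moreover have "finite {p. \<forall>x. (x \<in> {..<R} \<longrightarrow> p x \<in> {..q 0}) \<and> (x \<notin> {..<R} \<longrightarrow> p x = (0::nat))}"
    by (intro finite_set_of_finite_funs) auto
  ultimately show ?thesis by (rule finite_subset)
qed

lemma finite_strips: "finite (strips v a q)" if "par q"
  by (rule finite_subset[OF _ finite_below[OF that]]) (auto simp: strips_def)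

lemma strips_par: "p \<in> strips v a q \<Longrightarrow> par q \<Longrightarrow> par p"
  using par_le by (auto simp: strips_def)

lemma strips_0: "strips v 0 q = {q}" if "par q"
proof -
  have "p = q" if "p \<in> strips v 0 q" for p
    using that \<open>par q\<close> psize_le_eq by (auto simp: strips_def)
  moreover have "q \<in> strips v 0 q"
    using that by (auto simp: strips_def par_def antimono_def)
  ultimately show ?thesis by blast
qed

text \<open>Letters are listed from the largest down, so the head of the list is the outermost strip;
  the flag \<^const>\<open>True\<close> marks a vertical strip. Thus the letters \<open>(False, a)\<close> and \<open>(True, a)\<close>
  stand for pairing with \<open>h\<^sub>a\<close> and \<open>e\<^sub>a\<close>.\<close>

fun cnt :: "(bool \<times> nat) list \<Rightarrow> (nat \<Rightarrow> nat) \<Rightarrow> int" where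
  "cnt [] p = (if p = (\<lambda>_. 0) then 1 else 0)"
| "cnt ((v, a) # ls) p = (\<Sum>q\<in>strips v a p. cnt ls q)"

lemma cnt_zero_letter: "cnt (xs @ (v, 0) # ys) p = cnt (xs @ ys) p" if "par p"
  using that
proof (induction xs arbitrary: p)
  case (Cons x xs)
  then show ?case by (cases x) (auto intro!: sum.cong strips_par)
qed (simp add: strips_0)

lemma cnt_psize: "cnt ls p \<noteq> 0 \<Longrightarrow> par p \<Longrightarrow> psize p = sum_list (map snd ls)"
proof (induction ls arbitrary: p)
  case (Cons x ls)
  obtain v a where x: "x = (v, a)" by force
  obtain q where q: "q \<in> strips v a p" "cnt ls q \<noteq> 0"
    using Cons.prems(1) unfolding x by (auto elim: sum.not_neutral_contains_not_neutral)
  then show ?case using Cons.IH[OF q(2) strips_par[OF q(1) Cons.prems(2)]] x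
    by (auto simp: strips_def)
qed (auto simp: psize_zero split: if_splits)

lemma cnt_append_nonzero:
  "cnt (xs @ ys) p \<noteq> 0 \<Longrightarrow> par p \<Longrightarrow> \<exists>q\<le>p. par q \<and> cnt ys q \<noteq> 0"
proof (induction xs arbitrary: p)
  case (Cons x xs)
  obtain v a where x: "x = (v, a)" by force
  obtain q where q: "q \<in> strips v a p" "cnt (xs @ ys) q \<noteq> 0"
    using Cons.prems(1) unfolding x by (auto elim: sum.not_neutral_contains_not_neutral)
  then have "q \<le> p" "par q" using strips_par Cons.prems(2) by (auto simp: strips_def)
  with Cons.IH[OF q(2)] show ?case using order_trans by blast
qed auto

section \<open>Horizontal strips commute\<close>

text \<open>Between fixed outer shapes \<open>q \<subseteq> p\<close>, the rows of an intermediate shape range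
  independently over intervals; reflecting every interval exchanges the two strip sizes.\<close>

lemma hstrips_commute:
  fixes g :: "(nat \<Rightarrow> nat) \<Rightarrow> int"
  assumes p: "par p"
  shows "(\<Sum>r\<in>strips False a p. \<Sum>q\<in>strips False b r. g q) =
         (\<Sum>r\<in>strips False b p. \<Sum>q\<in>strips False a r. g q)"
proof -
  \<comment> \<open>Row \<open>i\<close> of an intermediate shape is at least row \<open>i\<close>
    of \<open>q\<close> and row \<open>i + 1\<close> of \<open>p\<close>, and at most row
    \<open>i\<close> of \<open>p\<close> and row \<open>i - 1\<close> of \<open>q\<close>; row 0 has
    no row above it.\<close>
  define lo where "lo q i = max (q i) (p (Suc i))" for q :: "nat \<Rightarrow> nat" and i
  define hi where "hi q i = (if i = 0 then p 0 else min (p i) (q (i - 1)))" for q :: "nat \<Rightarrow> nat" and i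
  define rf where "rf = (\<lambda>(r :: nat \<Rightarrow> nat, q :: nat \<Rightarrow> nat). (\<lambda>i. lo q i + hi q i - r i, q))"
  have bounds: "lo q i \<le> r i" "r i \<le> hi q i"
    if "r \<in> strips False a p" "q \<in> strips False b r" for r q a b i
  proof -
    show "lo q i \<le> r i" using that by (auto simp: strips_def lo_def le_fun_def)
    show "r i \<le> hi q i"
      using that by (cases i) (auto simp: strips_def hi_def le_fun_def)
  qed
  have step: "rf (r, q) \<in> (SIGMA r:strips False b p. strips False a r)"
    "rf (rf (r, q)) = (r, q)"
    if rq: "r \<in> strips False a p" "q \<in> strips False b r" for r q a b
  proof -
    have b: "lo q i \<le> r i" "r i \<le> hi q i" for i using bounds[OF rq] by auto
    show "rf (rf (r, q)) = (r, q)"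
      using b by (auto simp: rf_def fun_eq_iff intro!: diff_diff_cancel intro: trans_le_add2)
    define s where "s i = lo q i + hi q i - r i" for i
    have s: "lo q i \<le> s i" "s i \<le> hi q i" "s i + r i = lo q i + hi q i" for i
      using b[of i] by (auto simp: s_def)
    \<comment> \<open>Intervals of consecutive rows meet at most in an end point, so any choice of
      one value per interval is antitone.\<close>
    have lohi: "hi q (Suc i) \<le> lo q i" for i by (auto simp: lo_def hi_def)
    have am: "antimono s"
      unfolding antimono_iff_le_Suc using s lohi by (meson order_trans)
    have sp: "s i \<le> p i" "q i \<le> s i" "p (Suc i) \<le> s i" for i
      using s[of i] by (auto simp: lo_def hi_def split: if_splits)
    have qs: "s (Suc i) \<le> q i" for i using s(2)[of "Suc i"] by (simp add: hi_def)
    obtain R where R: "\<And>i. i \<ge> R \<Longrightarrow> p i = 0" using par_bound[OF p] by blast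
    have Rq: "\<And>i. i \<ge> R \<Longrightarrow> q i = 0" and Rs: "\<And>i. i \<ge> R \<Longrightarrow> s i = 0"
      and Rr: "\<And>i. i \<ge> R \<Longrightarrow> r i = 0"
    proof -
      fix i assume "i \<ge> R"
      then have "p i = 0" by (rule R)
      moreover have "r i \<le> p i" using rq by (auto simp: strips_def le_fun_def)
      ultimately show "q i = 0" "s i = 0" "r i = 0" using sp[of i] by auto
    qed
    \<comment> \<open>Shifted by one row, \<open>lo\<close> and \<open>hi\<close> are the maximum
      and the minimum of the same pair \<open>q i\<close>, \<open>p (Suc i)\<close>, so they add up
      to its sum.\<close>
    have "(\<Sum>i<m. lo q i) + (\<Sum>i<Suc m. hi q i) = (\<Sum>i<m. q i) + (\<Sum>i<Suc m. p i)" for m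
      by (induction m) (auto simp: lo_def hi_def)
    from this[of R] have "(\<Sum>i<R. s i + r i) = (\<Sum>i<R. q i) + (\<Sum>i<R. p i)"
      using R by (simp add: s(3) sum.distrib hi_def split: if_splits)
    then have "psize s + psize r = psize q + psize p"
      using psize_lessThan[of R p] psize_lessThan[of R q] psize_lessThan[of R s] psize_lessThan[of R r]
        R Rq Rs Rr by (simp add: sum.distrib)
    moreover have "psize p = psize r + a" "psize r = psize q + b" using rq by (auto simp: strips_def)
    ultimately have "psize p = psize s + b" "psize s = psize q + a" by auto
    then have "s \<in> strips False b p" "q \<in> strips False a s"
      using am sp qs rq by (auto simp: strips_def le_fun_def)
    then show "rf (r, q) \<in> (SIGMA r:strips False b p. strips False a r)"
      by (simp add: rf_def s_def[abs_def])
  qed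
  have fin: "finite (strips False a p)" "\<forall>r\<in>strips False a p. finite (strips False b r)" for a b
    using finite_strips strips_par p by blast+
  have inv: "rf (rf x) = x" "rf x \<in> (SIGMA r:strips False b p. strips False a r)"
    if x: "x \<in> (SIGMA r:strips False a p. strips False b r)" for x a b
  proof -
    obtain r q where "x = (r, q)" "r \<in> strips False a p" "q \<in> strips False b r"
      using x by (elim SigmaE)
    then show "rf (rf x) = x" "rf x \<in> (SIGMA r:strips False b p. strips False a r)"
      using step by (simp_all only:)
  qed
  have "snd (rf x) = snd x" for x by (simp add: rf_def split: prod.split)
  then have "(\<Sum>(r, q)\<in>(SIGMA r:strips False a p. strips False b r). g q) =
        (\<Sum>(r, q)\<in>(SIGMA r:strips False b p. strips False a r). g q)"
    by (intro sum.reindex_bij_witness[of _ rf rf]) (simp_all only: inv case_prod_beta)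
  then show ?thesis by (simp only: sum.Sigma[OF fin])
qed

lemma cnt_commute:
  "par p \<Longrightarrow> cnt (xs @ (False, a) # (False, b) # ys) p = cnt (xs @ (False, b) # (False, a) # ys) p"
proof (induction xs arbitrary: p)
  case (Cons x xs)
  then show ?case by (cases x) (auto intro!: sum.cong strips_par)
qed (simp add: hstrips_commute)

section \<open>The relation between horizontal and vertical strips\<close>

text \<open>The first row in which \<open>q\<close> and \<open>p\<close> differ can be toggled freely, which
  cancels all terms in the alternating sum expressing \<open>\<Sum> (-1)\<^sup>a h\<^sub>a e\<^bsub>k-a\<^esub> = 0\<close>.\<close>

lemma hv_cancel:
  assumes p: "par p" and q: "antimono q" and lt: "psize q < psize p"
  shows "(\<Sum>r | antimono r \<and> q \<le> r \<and> r \<le> p \<and> (\<forall>i. r (Suc i) \<le> q i) \<and> (\<forall>i. p i \<le> Suc (r i)).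
           (-1::int) ^ psize r) = 0" (is "sum ?f ?S = 0")
proof (cases "q \<le> p")
  case False
  then have "?S = {}" using order_trans by blast
  then show ?thesis by (simp only: sum.empty)
next
  case True
  have "\<exists>i. q i < p i"
  proof (rule ccontr)
    assume "\<not> ?thesis"
    then have "p \<le> q" by (auto simp: le_fun_def not_less)
    then show False using psize_mono[of p q] lt par_le[OF q True p] by simp
  qed
  define i where "i = (LEAST i. q i < p i)"
  have i: "q i < p i" unfolding i_def using \<open>\<exists>i. q i < p i\<close> by (rule LeastI_ex)
  have imin: "q k = p k" if "k < i" for k
    using not_less_Least[of k "\<lambda>i. q i < p i"] that True by (auto simp: i_def le_fun_def le_less)
  \<comment> \<open>Row \<open>i\<close> of each \<open>r\<close> in the set is \<open>p i\<close>
    or \<open>p i - 1\<close>, both at least \<open>q i\<close>; \<open>t\<close> exchanges these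
    two values.\<close>
  define t where "t r = r(i := (if r i = p i then p i - 1 else p i))" for r :: "nat \<Rightarrow> nat"
  have val: "r i = p i \<or> r i = p i - 1" if "r \<in> ?S" for r
  proof -
    have "r i \<le> p i" "p i \<le> Suc (r i)" using that by (auto simp: le_fun_def)
    then show ?thesis by linarith
  qed
  have tt: "t (t r) = r" if "r \<in> ?S" for r
    using val[OF that] i by (auto simp: t_def fun_eq_iff)
  have tS: "t r \<in> ?S" if "r \<in> ?S" for r
  proof -
    have r: "q k \<le> r k" "r k \<le> p k" "r (Suc k) \<le> q k" "p k \<le> Suc (r k)" for k
      using that by (auto simp: le_fun_def)
    have ti: "t r i \<le> p i" "p i \<le> Suc (t r i)" "q i \<le> t r i"
      using i by (auto simp: t_def)
    have 1: "q k \<le> t r k" "t r k \<le> p k" "p k \<le> Suc (t r k)" for k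
      using r[of k] ti by (cases "k = i"; simp add: t_def)+
    have 2: "t r (Suc k) \<le> q k" for k
    proof (cases "Suc k = i")
      case True
      \<comment> \<open>Above row \<open>i\<close> the shapes \<open>q\<close> and \<open>p\<close>
        agree, so even the full length \<open>p i\<close> fits under row \<open>k\<close> of
        \<open>q\<close>.\<close>
      then have "k < i" by linarith
      moreover have "antimono p" using p by (simp add: par_def)
      ultimately have "p i \<le> p k" "q k = p k" by (auto intro: imin antimonoD)
      then show ?thesis using True ti(1) by (metis order_trans)
    next
      case False
      then show ?thesis using r[of k] by (simp add: t_def)
    qed
    have "antimono (t r)" unfolding antimono_iff_le_Suc using 1 2 order_trans by blast
    then show ?thesis using 1 2 by (auto simp: le_fun_def)
  qed
  have sgn: "?f (t r) = - ?f r" if "r \<in> ?S" for r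
  proof -
    have fin: "finite {k. p k \<noteq> 0}" using p by (simp add: par_def)
    have *: "psize s = s i + sum s ({k. p k \<noteq> 0} - {i})" if "s \<in> ?S" for s
    proof -
      have "s k \<le> p k" for k using that by (auto simp: le_fun_def)
      then have "{k. s k \<noteq> 0} \<subseteq> {k. p k \<noteq> 0}" by (auto intro: less_le_trans)
      from psize_eq_sum[OF fin this] show ?thesis using i fin by (simp add: sum.remove)
    qed
    have "sum (t r) ({k. p k \<noteq> 0} - {i}) = sum r ({k. p k \<noteq> 0} - {i})"
      by (intro sum.cong) (auto simp: t_def)
    moreover have "odd (t r i + r i)" using val[OF that] i by (auto simp: t_def)
    ultimately have "odd (psize (t r) + psize r)" using *[OF that] *[OF tS[OF that]] by auto
    then show ?thesis by (auto simp: minus_one_power_iff)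
  qed
  have "sum f S = 0" if "\<And>r. r \<in> S \<Longrightarrow> t (t r) = r" "\<And>r. r \<in> S \<Longrightarrow> t r \<in> S"
    "\<And>r. r \<in> S \<Longrightarrow> f (t r) = - f r" for S and f :: "_ \<Rightarrow> int"
  proof -
    have "sum f S = sum (\<lambda>r. - f r) S"
      by (rule sum.reindex_bij_witness[of _ t t]) (simp_all add: that)
    then show ?thesis by (simp add: sum_negf)
  qed
  then show ?thesis by this (erule tt tS sgn)+
qed

text \<open>The alternating sum of h_a e_(K-a) with \<open>K = Suc k\<close> vanishes, because
  collecting its chains by the innermost shape leaves the sums cancelled by
  \<open>hv_cancel\<close>; the lemma solves this relation for the term with
  \<open>a = 0\<close>.\<close>

lemma e_strip_expansion:
  fixes g :: "(nat \<Rightarrow> nat) \<Rightarrow> int"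
  assumes p: "par p"
  shows "(\<Sum>q\<in>strips True (Suc k) p. g q) =
    (\<Sum>a=1..Suc k. (-1) ^ (a - 1) * (\<Sum>r\<in>strips True (Suc k - a) p. \<Sum>q\<in>strips False a r. g q))"
proof -
  define K where "K = Suc k"
  define Q where "Q = {q. antimono q \<and> q \<le> p \<and> psize p = psize q + K}"
  define S where "S q = {r. antimono r \<and> q \<le> r \<and> r \<le> p \<and> (\<forall>i. r (Suc i) \<le> q i) \<and> (\<forall>i. p i \<le> Suc (r i))}"
    for q
  \<comment> \<open>Since \<open>psize r = psize q + a\<close>, the sign (-1)^a is a product of
    signs of \<open>q\<close> and \<open>r\<close>, and \<open>a\<close> can be recovered from these
    shapes.\<close>
  define F :: "(nat \<Rightarrow> nat) \<Rightarrow> (nat \<Rightarrow> nat) \<Rightarrow> int" where "F q r = g q * (-1) ^ psize q * (-1) ^ psize r" for q r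
  have finQ: "finite Q" and finS: "finite (S q)" for q
    using finite_below[OF p] by (auto simp: Q_def S_def elim!: rev_finite_subset)
  have finV: "finite (strips True (K - a) p)" and finH: "r \<in> strips True (K - a) p \<Longrightarrow> finite (strips False a r)" for a r
    using finite_strips strips_par p by blast+
  define A where "A = (SIGMA a:{..K}. SIGMA r:strips True (K - a) p. strips False a r)"
  have "(\<Sum>a\<le>K. \<Sum>r\<in>strips True (K - a) p. \<Sum>q\<in>strips False a r. (-1) ^ a * g q) =
        (\<Sum>a\<le>K. \<Sum>r\<in>strips True (K - a) p. \<Sum>q\<in>strips False a r. F q r)"
    by (intro sum.cong refl) (auto simp: strips_def F_def power_add mult.assoc simp flip: power_mult_distrib)
  also have "\<dots> = (\<Sum>(a, r, q)\<in>A. F q r)"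
  proof -
    have "(\<Sum>r\<in>strips True (K - a) p. \<Sum>q\<in>strips False a r. F q r) =
        (\<Sum>(r, q)\<in>(SIGMA r:strips True (K - a) p. strips False a r). F q r)" for a
      using finV finH by (intro sum.Sigma) auto
    moreover have "finite (SIGMA r:strips True (K - a) p. strips False a r)" for a
      using finV finH by blast
    ultimately show ?thesis unfolding A_def by (simp add: sum.Sigma)
  qed
  also have "\<dots> = (\<Sum>(q, r)\<in>(SIGMA q:Q. S q). F q r)"
  proof (rule sum.reindex_bij_witness[of _ "\<lambda>(q, r). (psize r - psize q, r, q)" "\<lambda>(a, r, q). (q, r)"])
    fix x assume "x \<in> A"
    then obtain a r q where x: "x = (a, r, q)" and "a \<le> K" "r \<in> strips True (K - a) p" "q \<in> strips False a r"
      by (auto simp: A_def)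
    then show "(case case x of (a, r, q) \<Rightarrow> (q, r) of (q, r) \<Rightarrow> (psize r - psize q, r, q)) = x"
      "(case x of (a, r, q) \<Rightarrow> (q, r)) \<in> (SIGMA q:Q. S q)"
      by (auto simp: strips_def Q_def S_def)
  next
    fix y assume "y \<in> (SIGMA q:Q. S q)"
    then obtain q r where y: "y = (q, r)" "q \<in> Q" "r \<in> S q" by auto
    then have le: "q \<le> r" "r \<le> p" and "par r" using p par_le by (auto simp: S_def)
    then have "psize q \<le> psize r" "psize r \<le> psize p" using p by (auto intro: psize_mono)
    with y le show "(case y of (q, r) \<Rightarrow> (psize r - psize q, r, q)) \<in> A"
      by (auto simp: A_def strips_def Q_def S_def)
  qed auto
  also have "\<dots> = (\<Sum>q\<in>Q. g q * (-1) ^ psize q * (\<Sum>r\<in>S q. (-1) ^ psize r))"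
    using finQ finS by (subst sum.Sigma[symmetric]) (auto simp: F_def sum_distrib_left)
  also have "\<dots> = 0"
  proof (intro sum.neutral ballI)
    fix q assume "q \<in> Q"
    then have "(\<Sum>r\<in>S q. (-1::int) ^ psize r) = 0"
      unfolding S_def by (intro hv_cancel p) (auto simp: Q_def K_def)
    then show "g q * (-1) ^ psize q * (\<Sum>r\<in>S q. (-1) ^ psize r) = 0" by simp
  qed
  finally have zero: "(\<Sum>a\<le>K. (-1) ^ a * (\<Sum>r\<in>strips True (K - a) p. \<Sum>q\<in>strips False a r. g q)) = 0"
    by (simp add: sum_distrib_left)
  have "{..K} = insert 0 {1..K}" by auto
  moreover have "(\<Sum>r\<in>strips True K p. \<Sum>q\<in>strips False 0 r. g q) = (\<Sum>r\<in>strips True K p. g r)"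
    by (intro sum.cong refl) (simp add: strips_0 strips_par[OF _ p])
  ultimately have "(\<Sum>q\<in>strips True K p. g q) =
    - (\<Sum>a=1..K. (-1) ^ a * (\<Sum>r\<in>strips True (K - a) p. \<Sum>q\<in>strips False a r. g q))"
    using zero by simp
  also have "\<dots> = (\<Sum>a=1..K. (-1) ^ (a - 1) * (\<Sum>r\<in>strips True (K - a) p. \<Sum>q\<in>strips False a r. g q))"
    unfolding sum_negf[symmetric]
  proof (rule sum.cong[OF refl])
    fix a assume "a \<in> {1..K}"
    then obtain b where "a = Suc b" by (cases a) auto
    then show "- ((- 1) ^ a * (\<Sum>r\<in>strips True (K - a) p. sum g (strips False a r))) =
      (- 1) ^ (a - 1) * (\<Sum>r\<in>strips True (K - a) p. sum g (strips False a r))" by simp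
  qed
  finally show ?thesis by (simp only: K_def)
qed

lemma cnt_e_expansion:
  "par p \<Longrightarrow> cnt (xs @ (True, Suc k) # ys) p =
    (\<Sum>a=1..Suc k. (-1) ^ (a - 1) * cnt (xs @ (True, Suc k - a) # (False, a) # ys) p)"
proof (induction xs arbitrary: p)
  case Nil
  then show ?case using e_strip_expansion[of p "cnt ys" k] by simp
next
  case (Cons x xs)
  obtain v b where x: "x = (v, b)" by force
  have "cnt ((x # xs) @ (True, Suc k) # ys) p = (\<Sum>q\<in>strips v b p.
      \<Sum>a=1..Suc k. (-1) ^ (a - 1) * cnt (xs @ (True, Suc k - a) # (False, a) # ys) q)"
    using Cons strips_par by (auto simp: x intro!: sum.cong)
  also have "\<dots> = (\<Sum>a=1..Suc k. (-1) ^ (a - 1) *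
      (\<Sum>q\<in>strips v b p. cnt (xs @ (True, Suc k - a) # (False, a) # ys) q))"
    by (subst sum.swap) (simp add: sum_distrib_left)
  finally show ?case by (simp add: x)
qed

section \<open>Triangularity\<close>

text \<open>\<open>tr i k p\<close> consists of the boxes of \<open>p\<close> in its first \<open>k\<close> rows if \<open>k \<le> i\<close>, and of its
  first \<open>i\<close> rows and the first \<open>k - i\<close> columns otherwise. The letters \<open>LL i k p\<close> record
  the strips of the chain \<open>tr i 0 p \<subseteq> \<dots> \<subseteq> tr i k p\<close>.\<close>

definition tr :: "nat \<Rightarrow> nat \<Rightarrow> (nat \<Rightarrow> nat) \<Rightarrow> nat \<Rightarrow> nat" where
  "tr i k p r = (if r < i then if r < k then p r else 0 else min (p r) (k - i))"

definition LL :: "nat \<Rightarrow> nat \<Rightarrow> (nat \<Rightarrow> nat) \<Rightarrow> (bool \<times> nat) list" where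
  "LL i M p = map (\<lambda>k. (i \<le> k, psize (tr i (Suc k) p) - psize (tr i k p))) (rev [0..<M])"

lemma tr_le: "tr i k p \<le> p"
  by (auto simp: tr_def le_fun_def)

lemma tr_mono: "p \<le> q \<Longrightarrow> tr i k p \<le> tr i k q"
  by (auto simp: tr_def le_fun_def intro: min.coboundedI1)

lemma tr_Suc_le: "tr i k p \<le> tr i (Suc k) p"
  by (auto simp: tr_def le_fun_def)

lemma tr_0: "tr i 0 p = (\<lambda>_. 0)"
  by (auto simp: tr_def fun_eq_iff)

lemma par_decr: "par p \<Longrightarrow> r \<le> s \<Longrightarrow> p s \<le> p r"
  by (simp add: par_def antimonoD)

lemma tr_par: "par (tr i k p)" if "par p"
proof (rule par_le[OF _ tr_le that])
  have "p (Suc r) \<le> p r" for r using par_decr[OF that] by simp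
  then show "antimono (tr i k p)"
    unfolding antimono_iff_le_Suc by (auto simp: tr_def min_le_iff_disj intro: le_SucI)
qed

text \<open>For \<open>k < i\<close> the step adds row \<open>k\<close>, a horizontal strip; from
  then on it adds the part of column \<open>k - i\<close> in the rows from \<open>i\<close> on, a
  vertical strip.\<close>

lemma tr_strip:
  assumes "par p"
  shows "tr i k p \<in> strips (i \<le> k) (psize (tr i (Suc k) p) - psize (tr i k p)) (tr i (Suc k) p)"
proof -
  have "antimono (tr i k p)" using tr_par[OF assms] by (simp add: par_def)
  moreover have "psize (tr i k p) \<le> psize (tr i (Suc k) p)"
    by (intro psize_mono tr_Suc_le tr_par assms)
  moreover have "p (Suc r) \<le> p r" for r using par_decr[OF assms] by simp
  ultimately show ?thesis using tr_Suc_le[of i k p]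
    by (auto simp: strips_def) (auto simp: tr_def)
qed

text \<open>The innermost strips, up to \<open>i\<close> of them, are horizontal and open at most
  one new row each; the later ones are vertical and lengthen a row by at most one box each. So no
  shape built this way leaves the hook. The sizes \<open>g\<close> are arbitrary, which later allows
  dividing them by \<open>n\<close>.\<close>

lemma cnt_tr:
  "cnt (map (\<lambda>k. (i \<le> k, g k)) (rev [0..<M])) p \<noteq> 0 \<Longrightarrow> par p \<Longrightarrow> tr i M p = p"
proof (induction M arbitrary: p)
  case 0
  then show ?case by (auto simp: tr_0 split: if_splits)
next
  case (Suc M)
  obtain q where q: "q \<in> strips (i \<le> M) (g M) p" "cnt (map (\<lambda>k. (i \<le> k, g k)) (rev [0..<M])) q \<noteq> 0"
    using Suc.prems(1) by (auto elim: sum.not_neutral_contains_not_neutral)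
  have tq: "tr i M q = q" using Suc.IH[OF q(2)] strips_par[OF q(1) Suc.prems(2)] .
  have qr: "r < i \<Longrightarrow> r \<ge> M \<Longrightarrow> q r = 0" "r \<ge> i \<Longrightarrow> q r \<le> M - i" for r
    using fun_cong[OF tq, of r] by (auto simp: tr_def min_def split: if_splits)
  have "p r = tr i (Suc M) p r" for r
  proof (cases "i \<le> M")
    case True
    then have "p r \<le> Suc (q r)" using q(1) by (simp add: strips_def)
    then show ?thesis using qr(2)[of r] True by (cases "r < i") (auto simp: tr_def min_def)
  next
    case False
    then have *: "p (Suc r) \<le> q r" for r using q(1) by (simp add: strips_def)
    show ?thesis
    proof (cases r)
      case 0
      then show ?thesis using False by (simp add: tr_def)
    next
      case (Suc r')
      then show ?thesis using *[of r'] qr[of r'] False by (cases "r' < M"; cases "r' < i") (auto simp: tr_def)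
    qed
  qed
  then show ?case by (intro ext) (rule sym)
qed

lemma LL_sum: "par p \<Longrightarrow> sum_list (map snd (LL i M p)) = psize (tr i M p)"
proof (induction M)
  case (Suc M)
  then show ?case using psize_mono[OF tr_Suc_le tr_par, of p i M] by (simp add: LL_def)
qed (simp add: LL_def tr_0 psize_zero)

lemma LL_append: "k \<le> M \<Longrightarrow> \<exists>xs. LL i M p = xs @ LL i k p"
  using upt_add_eq_append[of 0 k "M - k"] by (auto simp: LL_def)

lemma cnt_LL_tr: "cnt (LL i k m) p \<noteq> 0 \<Longrightarrow> par p \<Longrightarrow> tr i k p = p"
  unfolding LL_def by (rule cnt_tr)

text \<open>After its \<open>k\<close> innermost strips a chain for the letters of \<open>m\<close>
  has reached a shape inside \<open>p\<close> of size \<open>psize (tr i k m)\<close>; being fixed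
  by \<open>tr i k\<close>, this shape lies in \<open>tr i k p\<close>.\<close>

lemma cnt_LL_dominated:
  assumes "cnt (LL i M m) p \<noteq> 0" "par m" "par p" "k \<le> M"
  shows "psize (tr i k m) \<le> psize (tr i k p)"
proof -
  obtain xs where "LL i M m = xs @ LL i k m" using LL_append[OF assms(4)] by blast
  then obtain q where q: "q \<le> p" "par q" "cnt (LL i k m) q \<noteq> 0"
    using cnt_append_nonzero[of xs "LL i k m" p] assms by auto
  have "tr i k q = q" using cnt_LL_tr q by blast
  then have "psize q \<le> psize (tr i k p)"
    using psize_mono[OF tr_mono[OF q(1)] tr_par[OF assms(3)]] by metis
  moreover have "psize q = psize (tr i k m)" using cnt_psize[OF q(3,2)] LL_sum[OF assms(2)] by simp
  ultimately show ?thesis by simp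
qed

text \<open>The chain of truncations is the only one: peeling the outermost strip leaves a shape
  fixed by \<open>tr i k\<close>, hence inside \<open>tr i k m\<close>, and of the same
  size.\<close>

lemma cnt_LL_diagonal: "par m \<Longrightarrow> cnt (LL i k m) (tr i k m) = 1"
proof (induction k)
  case 0
  then show ?case by (simp add: LL_def tr_0)
next
  case (Suc k)
  let ?A = "strips (i \<le> k) (psize (tr i (Suc k) m) - psize (tr i k m)) (tr i (Suc k) m)"
  have pm: "par (tr i (Suc k) m)" using tr_par Suc.prems by blast
  have "cnt (LL i k m) q = 0" if "q \<in> ?A - {tr i k m}" for q
  proof (rule ccontr)
    assume nz: "cnt (LL i k m) q \<noteq> 0"
    have q: "q \<le> tr i (Suc k) m" "par q"
      using that strips_par pm by (auto simp: strips_def)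
    have "tr i k q = q" using cnt_LL_tr nz q(2) by blast
    then have "q \<le> tr i k m" using tr_mono[OF order_trans[OF q(1) tr_le], of i k] by simp
    moreover have "psize q = psize (tr i k m)" using cnt_psize[OF nz q(2)] LL_sum[OF Suc.prems] by simp
    ultimately have "q = tr i k m" using psize_le_eq tr_par[OF Suc.prems] by blast
    with that show False by simp
  qed
  then have "(\<Sum>q\<in>?A. cnt (LL i k m) q) = (\<Sum>q\<in>{tr i k m}. cnt (LL i k m) q)"
    using tr_strip[OF Suc.prems] finite_strips[OF pm] by (intro sum.mono_neutral_right) auto
  then show ?case using Suc by (simp add: LL_def)
qed

text \<open>If the previous truncations agree, the next ones can differ only in one row, or only in
  one column restricted to the rows from \<open>i\<close> on. Such a column is filled from the top,
  so it is determined by its length, and lengths are comparable.\<close>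

lemma tr_comparable:
  assumes "par p" "par q" "tr i k p = tr i k q"
  shows "tr i (Suc k) p \<le> tr i (Suc k) q \<or> tr i (Suc k) q \<le> tr i (Suc k) p"
proof (cases "k < i")
  case True
  have eq: "p r = q r" if "r < k" for r
    using fun_cong[OF assms(3), of r] that True by (simp add: tr_def)
  show ?thesis using True eq linear[of "p k" "q k"] by (auto simp: tr_def le_fun_def less_Suc_eq)
next
  case False
  have eq: "p r = q r" if "r < i" for r
    using fun_cong[OF assms(3), of r] that False by (simp add: tr_def)
  define l where "l = k - i"
  have eq': "min (q r) l = min (p r) l" if "r \<ge> i" for r
    using fun_cong[OF assms(3), of r] that False by (simp add: tr_def l_def)
  have tr_col: "tr i (Suc k) x r = min (x r) (Suc l)" if "r \<ge> i" for x r
    using that False by (simp add: tr_def l_def Suc_diff_le)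
  show ?thesis
  proof (rule ccontr)
    assume "\<not> ?thesis"
    then obtain r s where r: "tr i (Suc k) q r < tr i (Suc k) p r" and s: "tr i (Suc k) p s < tr i (Suc k) q s"
      by (auto simp: le_fun_def not_le)
    have same: "tr i (Suc k) p t = tr i (Suc k) q t" if "t < i" for t
      using eq[OF that] that False by (simp add: tr_def)
    have ri: "r \<ge> i" and si: "s \<ge> i" using same r s by (metis leI less_irrefl)+
    have split: "x \<le> l \<and> y > l" if "min x (Suc l) < min y (Suc l)" "min x l = min y l" for x y
      using that by (simp add: min_def split: if_splits)
    have "q r \<le> l \<and> p r > l"
      by (rule split) (use r in \<open>simp_all only: tr_col[OF ri] eq'[OF ri]\<close>)
    moreover have "p s \<le> l \<and> q s > l"
      by (rule split) (use s in \<open>simp_all only: tr_col[OF si] eq'[OF si]\<close>)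
    \<comment> \<open>The upper of the rows \<open>r\<close> and \<open>s\<close> is at least as
      long as the lower one in both shapes, which refutes one of the two preceding facts.\<close>
    moreover have "p s \<le> p r \<and> q s \<le> q r \<or> p r \<le> p s \<and> q r \<le> q s"
      using par_decr assms(1,2) linear[of r s] by blast
    ultimately show False by linarith
  qed
qed

text \<open>Comparable truncations of equal size coincide, and their agreement makes the next ones
  comparable.\<close>

lemma tr_eqI:
  assumes "par p" "par q" "\<And>k. k \<le> M \<Longrightarrow> psize (tr i k p) = psize (tr i k q)"
  shows "tr i M p = tr i M q"
  using assms(3)
proof (induction M)
  case (Suc M)
  then have "tr i M p = tr i M q" "psize (tr i (Suc M) p) = psize (tr i (Suc M) q)" by auto
  with tr_comparable[OF assms(1,2)] show ?case
    using psize_le_eq tr_par assms(1,2) by metis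
qed (simp add: tr_0)

section \<open>Kostka numbers as counts of strip chains\<close>

text \<open>Semistandard tableaux over row-length functions, since removing a strip produces such a
  function and not a list.\<close>

definition tableaux :: "(nat \<Rightarrow> nat) \<Rightarrow> (nat \<Rightarrow> nat) \<Rightarrow> (nat \<Rightarrow> nat \<Rightarrow> nat) set" where
  "tableaux p alpha = {T.
     (\<forall>i j. \<not> j < p i \<longrightarrow> T i j = 0) \<and>
     (\<forall>i j j'. j \<le> j' \<and> j' < p i \<longrightarrow> T i j \<le> T i j') \<and>
     (\<forall>i i' j. i < i' \<and> j < p i' \<longrightarrow> T i j < T i' j) \<and>
     (\<forall>k. card {(i, j). j < p i \<and> T i j = k} = alpha k)}"

lemma kostka_tableaux: "kostka lam alpha = card (tableaux (part lam) alpha)"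
proof -
  have "{T. ssyt lam T \<and> content lam T = alpha} = tableaux (part lam) alpha"
    unfolding tableaux_def ssyt_def content_def fun_eq_iff by blast
  then show ?thesis by (simp add: kostka_def)
qed

lemma tableaux_entry_less:
  assumes "par p" "T \<in> tableaux p alpha" "\<forall>k\<ge>m. alpha k = 0" "j < p i"
  shows "T i j < m"
proof (rule ccontr)
  assume "\<not> T i j < m"
  then have "card {(i', j'). j' < p i' \<and> T i' j' = T i j} = 0"
    using assms(2,3) by (simp add: tableaux_def)
  \<comment> \<open>Finiteness matters because \<open>card\<close> also returns 0 on infinite
    sets.\<close>
  moreover have "finite {(i', j'). j' < p i' \<and> T i' j' = T i j}"
    by (rule finite_subset[OF _ psize_card(2)[of p]]) (use assms(1) in \<open>auto simp: par_def\<close>)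
  ultimately show False using assms(4) by auto
qed

text \<open>The largest letter \<open>m\<close> occupies row ends and, as columns increase strictly,
  at most one box per column. Erasing it therefore removes a horizontal strip; \<open>q i\<close> is
  the length of the initial run of entries below \<open>m\<close>.\<close>

lemma tableaux_removal:
  assumes p: "par p" and alpha: "\<forall>k\<ge>Suc m. alpha k = 0" and T: "T \<in> tableaux p alpha"
  defines "q \<equiv> \<lambda>i. LEAST j. \<not> (j < p i \<and> T i j < m)"
  shows "\<And>i j. j < q i \<longleftrightarrow> j < p i \<and> T i j < m"
    and "q \<in> strips False (alpha m) p"
    and "(\<lambda>i j. if T i j < m then T i j else 0) \<in> tableaux q (alpha(m := 0))"
proof -
  have T0: "\<not> j < p i \<Longrightarrow> T i j = 0"
    and Trow: "j \<le> j' \<Longrightarrow> j' < p i \<Longrightarrow> T i j \<le> T i j'"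
    and Tcol: "i < i' \<Longrightarrow> j < p i' \<Longrightarrow> T i j < T i' j"
    and Tc: "card {(i, j). j < p i \<and> T i j = k} = alpha k" for i i' j j' k
    using T unfolding tableaux_def by blast+
  have Tm: "T i j \<le> m" if "j < p i" for i j
    using tableaux_entry_less[OF p T alpha that] by simp
  show qiff: "j < q i \<longleftrightarrow> j < p i \<and> T i j < m" for i j
  proof
    assume "j < q i"
    then show "j < p i \<and> T i j < m" unfolding q_def using not_less_Least by blast
  next
    assume j: "j < p i \<and> T i j < m"
    have "\<exists>j. \<not> (j < p i \<and> T i j < m)" by blast
    then have "\<not> (q i < p i \<and> T i (q i) < m)" unfolding q_def by (rule LeastI_ex)
    then show "j < q i" using j Trow[of "q i" j i] by (metis le_less_trans not_le)
  qed
  have qp: "q \<le> p" using qiff by (metis le_fun_def leI order_less_irrefl)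
  have interlace: "p (Suc i) \<le> q i" for i
  proof (rule ccontr)
    assume "\<not> ?thesis"
    then have *: "q i < p (Suc i)" by simp
    then have "T i (q i) < m" using Tcol[of i "Suc i" "q i"] Tm[of "q i" "Suc i"] by simp
    moreover have "q i < p i" using * par_decr[OF p, of i "Suc i"] by simp
    ultimately show False using qiff[of "q i" i] by simp
  qed
  have am: "antimono q" unfolding antimono_iff_le_Suc
    using interlace qp by (meson le_funD order_trans)
  have fin: "finite {i. p i \<noteq> 0}" using p by (simp add: par_def)
  have finq: "finite {i. q i \<noteq> 0}" using finite_support_le[OF qp fin] .
  have "{(i, j). j < p i} = {(i, j). j < q i} \<union> {(i, j). j < p i \<and> T i j = m}"
    using Tm by (auto simp: qiff le_less)
  moreover have "{(i, j). j < q i} \<inter> {(i, j). j < p i \<and> T i j = m} = {}"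
    by (auto simp: qiff)
  ultimately have "psize p = psize q + alpha m"
    using psize_card[OF fin] psize_card[OF finq] Tc[of m]
    by (metis (no_types, lifting) card_Un_disjoint finite_Un)
  then show "q \<in> strips False (alpha m) p"
    using am qp interlace by (simp add: strips_def)
  have "{(i, j). j < q i \<and> (if T i j < m then T i j else 0) = k} =
      (if k < m then {(i, j). j < p i \<and> T i j = k} else {})" for k
    by (auto simp: qiff)
  then have "card {(i, j). j < q i \<and> (if T i j < m then T i j else 0) = k} = (alpha(m := 0)) k" for k
    using Tc alpha by auto
  moreover have "(if T i j < m then T i j else 0) = 0" if "\<not> j < q i" for i j
    using that T0 by (auto simp: qiff)
  moreover have "(if T i j < m then T i j else 0) \<le> (if T i j' < m then T i j' else 0)"
    if "j \<le> j'" "j' < q i" for i j j'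
    using that Trow[of j j' i] by (auto simp: qiff)
  moreover have "(if T i j < m then T i j else 0) < (if T i' j < m then T i' j else 0)"
    if "i < i'" "j < q i'" for i i' j
    using that Tcol[of i i' j] by (auto simp: qiff)
  ultimately show "(\<lambda>i j. if T i j < m then T i j else 0) \<in> tableaux q (alpha(m := 0))"
    unfolding tableaux_def by blast
qed

text \<open>The inverse of erasing the largest letter: every box of the strip between
  \<open>q\<close> and \<open>p\<close> is filled with \<open>m\<close>.\<close>

lemma tableaux_insertion:
  assumes p: "par p" and alpha: "\<forall>k\<ge>Suc m. alpha k = 0"
    and q: "q \<in> strips False (alpha m) p" and T: "T \<in> tableaux q (alpha(m := 0))"
  defines "T' \<equiv> \<lambda>i j. if j < q i then T i j else if j < p i then m else 0"
  shows "T' \<in> tableaux p alpha"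
    and "\<And>i j. j < q i \<longleftrightarrow> j < p i \<and> T' i j < m"
    and "\<And>i j. (if T' i j < m then T' i j else 0) = T i j"
proof -
  have T0: "\<not> j < q i \<Longrightarrow> T i j = 0"
    and Trow: "j \<le> j' \<Longrightarrow> j' < q i \<Longrightarrow> T i j \<le> T i j'"
    and Tcol: "i < i' \<Longrightarrow> j < q i' \<Longrightarrow> T i j < T i' j"
    and Tc: "card {(i, j). j < q i \<and> T i j = k} = (alpha(m := 0)) k" for i i' j j' k
    using T unfolding tableaux_def by blast+
  have parq: "par q" using strips_par[OF q p] .
  have qp: "q i \<le> p i" and interlace: "p (Suc i) \<le> q i" for i
    using q by (auto simp: strips_def le_fun_def)
  have Tm: "T i j < m" if "j < q i" for i j
    by (rule tableaux_entry_less[OF parq T _ that]) (use alpha in simp)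
  show iff: "j < q i \<longleftrightarrow> j < p i \<and> T' i j < m" for i j
    using Tm qp[of i] by (auto simp: T'_def)
  show "(if T' i j < m then T' i j else 0) = T i j" for i j
    using Tm T0 by (auto simp: T'_def)
  have 1: "T' i j = 0" if "\<not> j < p i" for i j
    using that qp[of i] by (simp add: T'_def)
  have 2: "T' i j \<le> T' i j'" if "j \<le> j'" "j' < p i" for i j j'
    using that Trow[of j j' i] Tm[of j i] by (auto simp: T'_def)
  have 3: "T' i j < T' i' j" if "i < i'" "j < p i'" for i i' j
  proof -
    \<comment> \<open>By interlacing, every box of \<open>p\<close> in a lower row lies under a box
      of \<open>q\<close> in row \<open>i\<close>, whose entry is below \<open>m\<close>.\<close>
    have "p i' \<le> p (Suc i)" using that(1) by (intro par_decr[OF p]) simp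
    then have j: "j < q i" using interlace[of i] that by simp
    then show ?thesis using that Tcol[of i i' j] Tm[of j i] by (auto simp: T'_def)
  qed
  have 4: "card {(i, j). j < p i \<and> T' i j = k} = alpha k" for k
  proof (cases "k = m")
    case True
    have fin: "finite {i. p i \<noteq> 0}" "finite {i. q i \<noteq> 0}" using p parq by (auto simp: par_def)
    have "{(i, j). j < p i \<and> T' i j = m} = {(i, j). j < p i} - {(i, j). j < q i}"
      using Tm by (auto simp: T'_def)
    moreover have "{(i, j). j < q i} \<subseteq> {(i, j). j < p i}"
      using qp by (auto intro: less_le_trans)
    ultimately have "card {(i, j). j < p i \<and> T' i j = m} = psize p - psize q"
      using psize_card[OF fin(1)] psize_card[OF fin(2)] by (simp add: card_Diff_subset)
    then show ?thesis using q True by (simp add: strips_def)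
  next
    case False
    have "{(i, j). j < p i \<and> T' i j = k} = {(i, j). j < q i \<and> T i j = k}"
      using False qp by (auto simp: T'_def intro: less_le_trans split: if_splits)
    then show ?thesis using Tc[of k] False by simp
  qed
  show "T' \<in> tableaux p alpha" unfolding tableaux_def using 1 2 3 4 by blast
qed

lemma tableaux_bij:
  assumes p: "par p" and alpha: "\<forall>k\<ge>Suc m. alpha k = 0"
  shows "bij_betw (\<lambda>T. (\<lambda>i. LEAST j. \<not> (j < p i \<and> T i j < m), \<lambda>i j. if T i j < m then T i j else 0))
     (tableaux p alpha) (SIGMA q:strips False (alpha m) p. tableaux q (alpha(m := 0)))"
    (is "bij_betw ?F ?A ?B")
proof (rule bij_betw_byWitness[where f' = "\<lambda>(q, T) i j. if j < q i then T i j else if j < p i then m else 0"])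
  show "?F ` ?A \<subseteq> ?B" using tableaux_removal(2,3)[OF p alpha] by auto
  show "(\<lambda>(q, T) i j. if j < q i then T i j else if j < p i then m else 0) ` ?B \<subseteq> ?A"
    using tableaux_insertion(1)[OF p alpha] by auto
  show "\<forall>T\<in>?A. (case ?F T of (q, T) \<Rightarrow> \<lambda>i j. if j < q i then T i j else if j < p i then m else 0) = T"
  proof
    fix T assume T: "T \<in> ?A"
    have "T i j \<le> m" if "j < p i" for i j
      using tableaux_entry_less[OF p T alpha that] by simp
    moreover have "T i j = 0" if "\<not> j < p i" for i j using T that by (simp add: tableaux_def)
    ultimately show "(case ?F T of (q, T) \<Rightarrow> \<lambda>i j. if j < q i then T i j else if j < p i then m else 0) = T"
      unfolding prod.case tableaux_removal(1)[OF p alpha T]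
      by (intro ext) (auto simp: le_less)
  qed
  show "\<forall>y\<in>?B. ?F (case y of (q, T) \<Rightarrow> \<lambda>i j. if j < q i then T i j else if j < p i then m else 0) = y"
  proof
    fix y assume "y \<in> ?B"
    then obtain q T where y: "y = (q, T)" and q: "q \<in> strips False (alpha m) p"
      and T: "T \<in> tableaux q (alpha(m := 0))" by auto
    define T' where "T' = (\<lambda>i j. if j < q i then T i j else if j < p i then m else 0)"
    have iff: "j < q i \<longleftrightarrow> j < p i \<and> T' i j < m" for i j
      using tableaux_insertion(2)[OF p alpha q T] unfolding T'_def .
    have "(LEAST j. \<not> (j < p i \<and> T' i j < m)) = q i" for i
      unfolding iff[symmetric] not_less by (rule Least_equality) auto
    moreover have "(if T' i j < m then T' i j else 0) = T i j" for i j
      using tableaux_insertion(3)[OF p alpha q T] unfolding T'_def .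
    ultimately have "?F T' = (q, T)" by auto
    moreover have "(case y of (q, T) \<Rightarrow> \<lambda>i j. if j < q i then T i j else if j < p i then m else 0) = T'"
      by (simp add: y T'_def)
    ultimately show "?F (case y of (q, T) \<Rightarrow> \<lambda>i j. if j < q i then T i j else if j < p i then m else 0) = y"
      by (simp only: y)
  qed
qed

text \<open>Erasing the letters \<open>m - 1, ..., 0\<close> in turn makes a tableau a chain of
  horizontal strips. Finiteness is carried through the induction because counting the disjoint union
  requires it.\<close>

lemma card_tableaux:
  "par p \<Longrightarrow> (\<forall>k\<ge>m. alpha k = 0) \<Longrightarrow>
   finite (tableaux p alpha) \<and>
   int (card (tableaux p alpha)) = cnt (map (\<lambda>k. (False, alpha k)) (rev [0..<m])) p"
proof (induction m arbitrary: p alpha)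
  case 0
  show ?case
  proof (cases "p = (\<lambda>_. 0)")
    case True
    then have "tableaux p alpha = {\<lambda>_ _. 0}" using 0 by (auto simp: tableaux_def fun_eq_iff)
    then show ?thesis using True by simp
  next
    case False
    then obtain i where "0 < p i" by auto
    then have "tableaux p alpha = {}"
      using tableaux_entry_less[OF 0(1) _ 0(2), of _ 0 i] by auto
    then show ?thesis using False by simp
  qed
next
  case (Suc m)
  define A where "A = strips False (alpha m) p"
  define beta where "beta = alpha(m := 0)"
  have IH: "finite (tableaux q beta)"
    "int (card (tableaux q beta)) = cnt (map (\<lambda>k. (False, alpha k)) (rev [0..<m])) q" if "q \<in> A" for q
  proof -
    have "par q" using that strips_par Suc.prems(1) by (simp add: A_def)
    then have "finite (tableaux q beta) \<and>
        int (card (tableaux q beta)) = cnt (map (\<lambda>k. (False, beta k)) (rev [0..<m])) q"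
      by (rule Suc.IH) (use Suc.prems(2) in \<open>simp add: beta_def\<close>)
    moreover have "map (\<lambda>k. (False, beta k)) (rev [0..<m]) = map (\<lambda>k. (False, alpha k)) (rev [0..<m])"
      by (simp add: beta_def)
    ultimately show "finite (tableaux q beta)"
      "int (card (tableaux q beta)) = cnt (map (\<lambda>k. (False, alpha k)) (rev [0..<m])) q" by auto
  qed
  have finA: "finite A" using finite_strips Suc.prems(1) by (simp add: A_def)
  note bij = tableaux_bij[of p m alpha, OF Suc.prems(1) Suc.prems(2), folded A_def beta_def]
  have "finite (SIGMA q:A. tableaux q beta)" using finA IH(1) by blast
  then have "finite (tableaux p alpha)" using bij_betw_finite[OF bij] by simp
  moreover have "card (tableaux p alpha) = (\<Sum>q\<in>A. card (tableaux q beta))"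
    using bij_betw_same_card[OF bij] finA IH(1) by simp
  ultimately show ?case using IH(2) by (simp add: A_def)
qed

section \<open>Schur coefficients: strip counts, degree and symmetry\<close>

lemma sorted_ge_nth: "is_partition lam \<Longrightarrow> i \<le> j \<Longrightarrow> j < length lam \<Longrightarrow> lam ! j \<le> lam ! i"
  unfolding is_partition_def by (metis le_neq_implies_less order_refl sorted_wrt_nth_less)

lemma part_par: "par (part lam)" if "is_partition lam"
proof -
  have "antimono (part lam)" using sorted_ge_nth[OF that] by (auto simp: part_def antimono_def)
  moreover have "finite {i. part lam i \<noteq> 0}"
    by (rule finite_subset[of _ "{..<length lam}"]) (auto simp: part_def split: if_splits)
  ultimately show ?thesis by (simp add: par_def)
qed

lemma schur_cnt:
  assumes "is_partition lam" "\<forall>k\<ge>m. alpha k = 0"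
  shows "schur lam alpha = cnt (map (\<lambda>k. (False, alpha k)) (rev [0..<m])) (part lam)"
  using card_tableaux[OF part_par[OF assms(1)] assms(2)]
  unfolding schur_def kostka_tableaux by simp

lemma schur_nonzero_finite:
  assumes "is_partition lam" "schur lam alpha \<noteq> 0"
  shows "finite {k. alpha k \<noteq> 0}"
proof -
  have "tableaux (part lam) alpha \<noteq> {}"
    using assms(2) by (auto simp: schur_def kostka_tableaux)
  then obtain T where T: "card {(i, j). j < part lam i \<and> T i j = k} = alpha k" for k
    by (auto simp: tableaux_def)
  have "{k. alpha k \<noteq> 0} \<subseteq> (\<lambda>(i, j). T i j) ` {(i, j). j < part lam i}"
  proof
    fix k assume "k \<in> {k. alpha k \<noteq> 0}"
    then have "card {(i, j). j < part lam i \<and> T i j = k} \<noteq> 0" using T[of k] by simp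
    then have "{(i, j). j < part lam i \<and> T i j = k} \<noteq> {}" by (metis card.empty)
    then show "k \<in> (\<lambda>(i, j). T i j) ` {(i, j). j < part lam i}" by auto
  qed
  moreover have "finite {(i, j). j < part lam i}"
    using part_par[OF assms(1)] psize_card(2) by (simp add: par_def)
  ultimately show ?thesis using finite_surj by blast
qed

lemma schur_degree:
  assumes "is_partition lam" "schur lam alpha \<noteq> 0"
  shows "psize alpha = psize (part lam)"
proof -
  obtain m where "\<forall>k\<in>{k. alpha k \<noteq> 0}. k < m"
    using schur_nonzero_finite[OF assms] finite_nat_set_iff_bounded by blast
  then have m: "\<forall>k\<ge>m. alpha k = 0" by force
  have "psize (part lam) = sum_list (map snd (map (\<lambda>k. (False, alpha k)) (rev [0..<m])))"
    by (rule cnt_psize) (use assms schur_cnt[OF assms(1) m] part_par in auto)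
  also have "\<dots> = (\<Sum>k<m. alpha k)"
    by (simp add: o_def rev_map[symmetric] sum_list_rev interv_sum_list_conv_sum_set_nat atLeast0LessThan)
  also have "\<dots> = psize alpha" using psize_lessThan[of m alpha] m by simp
  finally show ?thesis by simp
qed

text \<open>An adjacent transposition of exponents; invariance under every \<open>swp k\<close>
  expresses that a coefficient function is symmetric.\<close>

definition swp :: "nat \<Rightarrow> (nat \<Rightarrow> nat) \<Rightarrow> nat \<Rightarrow> nat" where
  "swp k alpha = alpha(k := alpha (Suc k), Suc k := alpha k)"

lemma swp_swp: "swp k (swp k alpha) = alpha"
  by (auto simp: swp_def fun_eq_iff)

text \<open>In terms of strip counts the transposition exchanges two neighbouring horizontal
  letters, and these commute.\<close>

lemma schur_swp_finite:
  assumes lam: "is_partition lam" and fin: "finite {k. alpha k \<noteq> 0}"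
  shows "schur lam (swp k alpha) = schur lam alpha"
proof -
  obtain m' where "\<forall>i\<in>{k. alpha k \<noteq> 0}. i < m'"
    using fin finite_nat_set_iff_bounded by blast
  then have m': "\<forall>i\<ge>m'. alpha i = 0" by force
  \<comment> \<open>This bound exceeds both the support and \<open>Suc k\<close>, so both exchanged
    letters occur in the list.\<close>
  define m where "m = Suc (Suc k) + m'"
  have m: "\<forall>i\<ge>m. alpha i = 0" "\<forall>i\<ge>m. swp k alpha i = 0"
    using m' by (auto simp: m_def swp_def)
  have "rev [0..<m] = rev [Suc (Suc k)..<m] @ Suc k # k # rev [0..<k]"
    unfolding m_def using upt_add_eq_append[of 0 "Suc (Suc k)" m'] by simp
  moreover have "map (\<lambda>i. (False, swp k alpha i)) (rev [0..<k]) = map (\<lambda>i. (False, alpha i)) (rev [0..<k])"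
    "map (\<lambda>i. (False, swp k alpha i)) (rev [Suc (Suc k)..<m]) = map (\<lambda>i. (False, alpha i)) (rev [Suc (Suc k)..<m])"
    by (auto simp: swp_def)
  moreover have "swp k alpha k = alpha (Suc k)" "swp k alpha (Suc k) = alpha k" by (auto simp: swp_def)
  ultimately show ?thesis
    using schur_cnt[OF lam m(1)] schur_cnt[OF lam m(2)] cnt_commute[OF part_par[OF lam]]
    by (simp only: map_append list.map)
qed

lemma schur_swp:
  assumes lam: "is_partition lam"
  shows "schur lam (swp k alpha) = schur lam alpha"
proof (rule ccontr)
  assume ne: "schur lam (swp k alpha) \<noteq> schur lam alpha"
  then have "schur lam (swp k alpha) \<noteq> 0 \<or> schur lam alpha \<noteq> 0" by auto
  then show False
    using schur_nonzero_finite[OF lam] schur_swp_finite[OF lam, of alpha k]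
      schur_swp_finite[OF lam, of "swp k alpha" k] ne by (metis swp_swp)
qed

section \<open>Schur expansions exist and are unique\<close>

lemma ex_partition: "\<exists>nu. is_partition nu \<and> part nu = p" if p: "par p"
proof -
  obtain R where R: "\<And>i. i \<ge> R \<Longrightarrow> p i = 0" using par_bound[OF p] by blast
  define M where "M = (LEAST i. p i = 0)"
  have "p R = 0" by (simp add: R)
  then have "p M = 0" unfolding M_def by (rule LeastI[of "\<lambda>i. p i = 0"])
  then have M0: "p i = 0" if "i \<ge> M" for i using par_decr[OF p that] by simp
  have Mpos: "p i \<noteq> 0" if "i < M" for i using that not_less_Least unfolding M_def by blast
  have "0 \<notin> set (map p [0..<M])" using Mpos by (metis atLeastLessThan_iff image_iff set_map set_upt)
  moreover have "sorted_wrt (\<ge>) (map p [0..<M])"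
    by (simp add: sorted_wrt_iff_nth_less par_decr[OF p])
  ultimately have "is_partition (map p [0..<M])" by (simp add: is_partition_def)
  moreover have "part (map p [0..<M]) = p" using M0 by (auto simp: part_def fun_eq_iff)
  ultimately show ?thesis by blast
qed

lemma part_nonzero: "is_partition nu \<Longrightarrow> i < length nu \<Longrightarrow> part nu i \<noteq> 0"
  unfolding is_partition_def part_def by (metis nth_mem)

lemma part_inj:
  assumes "is_partition nu" "is_partition mu" "part nu = part mu"
  shows "nu = mu"
proof -
  have len: "length mu \<le> length nu"
    if "is_partition nu" "is_partition mu" "part nu = part mu" for nu mu
  proof (rule ccontr)
    assume "\<not> ?thesis"
    then have "part mu (length nu) \<noteq> 0" using part_nonzero that(2) by simp
    moreover have "part nu (length nu) = 0" by (simp add: part_def)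
    ultimately show False using that(3) by simp
  qed
  have l: "length nu = length mu" using len assms by (metis order_antisym)
  show ?thesis
  proof (rule nth_equalityI[OF l])
    fix i assume "i < length nu"
    then show "nu ! i = mu ! i" using fun_cong[OF assms(3), of i] l by (simp add: part_def)
  qed
qed

lemma psize_ge_sum: "sum p A \<le> psize p" if "finite A" "finite {i. p i \<noteq> 0}"
proof -
  have "psize p = sum p (A \<union> {i. p i \<noteq> 0})" using that by (intro psize_eq_sum) auto
  moreover have "sum p A \<le> sum p (A \<union> {i. p i \<noteq> 0})" using that by (intro sum_mono2) auto
  ultimately show ?thesis by simp
qed

lemma psize_bounds:
  assumes "par p"
  shows "p r \<le> psize p" and "r \<ge> psize p \<Longrightarrow> p r = 0"
proof -
  have fin: "finite {i. p i \<noteq> 0}" using assms by (simp add: par_def)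
  show "p r \<le> psize p" using psize_ge_sum[of "{r}", OF _ fin] by simp
  assume r: "r \<ge> psize p"
  show "p r = 0"
  proof (rule ccontr)
    assume "p r \<noteq> 0"
    then have "1 \<le> p i" if "i \<le> r" for i using par_decr[OF assms that] by simp
    then have "(\<Sum>i\<le>r. 1) \<le> sum p {..r}" by (intro sum_mono) auto
    then have "Suc r \<le> sum p {..r}" by simp
    then show False using psize_ge_sum[of "{..r}", OF _ fin] r by simp
  qed
qed

definition partitions_of :: "nat \<Rightarrow> nat list set" where
  "partitions_of N = {nu. is_partition nu \<and> psize (part nu) = N}"

lemma finite_partitions_of: "finite (partitions_of N)"
proof (rule finite_imageD[of part])
  define b where "b = (\<lambda>r. if r < N then N else 0)"
  have "par b"
    unfolding par_def by (auto simp: b_def antimono_def intro: finite_subset[of _ "{..<N}"])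
  moreover have "part ` partitions_of N \<subseteq> {p. p \<le> b}"
    using psize_bounds part_par by (auto simp: b_def le_fun_def partitions_of_def not_less)
  ultimately show "finite (part ` partitions_of N)" using finite_below finite_subset by blast
  show "inj_on part (partitions_of N)"
    using part_inj by (auto simp: inj_on_def partitions_of_def)
qed

section \<open>Triangular systems and uniqueness of Schur expansions\<close>

lemma LL_rows: "LL M M p = map (\<lambda>k. (False, tr M M p k)) (rev [0..<M])"
proof -
  have sz: "psize (tr M k p) = (\<Sum>r<k. p r)" if "k \<le> M" for k
    using that by (subst psize_lessThan[of k]) (auto simp: tr_def intro!: sum.cong)
  have "psize (tr M (Suc k) p) - psize (tr M k p) = tr M M p k" if "k < M" for k
    using that by (simp add: sz) (simp add: tr_def)
  then show ?thesis by (auto simp: LL_def)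
qed

text \<open>Taking \<open>i = M\<close> leaves no vertical letters, so that the triangularity of
  pairings specializes to that of Kostka numbers.\<close>

lemma cnt_LL_rows:
  assumes "is_partition nu"
  shows "cnt (LL M M p) (part nu) = schur nu (tr M M p)"
proof -
  have "\<forall>k\<ge>M. tr M M p k = 0" by (simp add: tr_def)
  from schur_cnt[OF assms this] show ?thesis by (simp add: LL_rows)
qed

lemma tr_rows: "tr M M p = p" if "\<And>r. r \<ge> M \<Longrightarrow> p r = 0"
  using that by (auto simp: tr_def fun_eq_iff)

text \<open>One number that linearizes the comparison in \<open>cnt_LL_dominated\<close>: under that
  domination ranks increase weakly, and equal ranks force all truncation sizes to agree.\<close>

definition rank :: "nat \<Rightarrow> nat \<Rightarrow> nat list \<Rightarrow> nat" where
  "rank i M nu = (\<Sum>k\<le>M. psize (tr i k (part nu)))"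

lemma cnt_LL_rank:
  assumes nz: "cnt (LL i M (part mu)) (part nu) \<noteq> 0" and mu: "is_partition mu" and nu: "is_partition nu"
  shows "rank i M mu \<le> rank i M nu"
    and "tr i M (part mu) = part mu \<Longrightarrow> rank i M mu = rank i M nu \<Longrightarrow> mu = nu"
proof -
  have dom: "psize (tr i k (part mu)) \<le> psize (tr i k (part nu))" if "k \<le> M" for k
    using cnt_LL_dominated[OF nz] part_par mu nu that by blast
  then show "rank i M mu \<le> rank i M nu" unfolding rank_def by (intro sum_mono) simp
  assume trm: "tr i M (part mu) = part mu" and eq: "rank i M mu = rank i M nu"
  have "psize (tr i k (part mu)) = psize (tr i k (part nu))" if "k \<le> M" for k
  proof (rule ccontr)
    assume "\<not> ?thesis"
    then have "psize (tr i k (part mu)) < psize (tr i k (part nu))" using dom[OF that] by simp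
    then have "rank i M mu < rank i M nu"
      unfolding rank_def using dom that by (intro sum_strict_mono_ex1) auto
    then show False using eq by simp
  qed
  then have "tr i M (part mu) = tr i M (part nu)"
    using tr_eqI part_par mu nu by blast
  moreover have "tr i M (part nu) = part nu" using cnt_LL_tr[OF nz] part_par nu by blast
  ultimately show "mu = nu" using part_inj mu nu trm by simp
qed

lemma cnt_LL_same:
  "is_partition mu \<Longrightarrow> tr i M (part mu) = part mu \<Longrightarrow> cnt (LL i M (part mu)) (part mu) = 1"
  using cnt_LL_diagonal[of "part mu" i M] part_par by simp

text \<open>Otherwise choose, among the shapes in the hook with nonzero coefficient, one of largest
  rank. In the equation for its letters only the diagonal term survives, and its pairing is
  1.\<close>

lemma triangular_vanishing:
  assumes fin: "finite S" and S: "\<And>nu. nu \<in> S \<Longrightarrow> is_partition nu"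
    and zero: "\<And>mu. is_partition mu \<Longrightarrow> (\<Sum>nu\<in>S. c nu * cnt (LL i M (part mu)) (part nu)) = 0"
    and mu: "mu \<in> S" "tr i M (part mu) = part mu"
  shows "c mu = 0"
proof (rule ccontr)
  assume "c mu \<noteq> 0"
  define B where "B = {nu \<in> S. tr i M (part nu) = part nu \<and> c nu \<noteq> 0}"
  have "finite B" "B \<noteq> {}" using fin mu \<open>c mu \<noteq> 0\<close> by (auto simp: B_def)
  then obtain m where m: "m \<in> B" "\<And>nu. nu \<in> B \<Longrightarrow> rank i M nu \<le> rank i M m"
  proof -
    have fin': "finite (rank i M ` B)" and "rank i M ` B \<noteq> {}"
      using \<open>finite B\<close> \<open>B \<noteq> {}\<close> by simp_all
    then have "Max (rank i M ` B) \<in> rank i M ` B" by (rule Max_in)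
    then obtain m where "m \<in> B" "rank i M m = Max (rank i M ` B)" by force
    then show ?thesis using that[of m] Max_ge[OF fin'] by simp
  qed
  have mS: "m \<in> S" "is_partition m" "tr i M (part m) = part m" "c m \<noteq> 0"
    using m(1) S by (auto simp: B_def)
  have "c nu * cnt (LL i M (part m)) (part nu) = 0" if nu: "nu \<in> S - {m}" for nu
  proof (rule ccontr)
    assume "\<not> ?thesis"
    then have nz: "cnt (LL i M (part m)) (part nu) \<noteq> 0" and "c nu \<noteq> 0" by auto
    have pnu: "is_partition nu" using S nu by simp
    \<comment> \<open>Shapes of \<open>S\<close> outside the hook pair to zero with these letters,
      so their coefficients do not disturb the equation.\<close>
    have "tr i M (part nu) = part nu" using cnt_LL_tr[OF nz] part_par pnu by blast
    then have "nu \<in> B" using nu \<open>c nu \<noteq> 0\<close> by (simp add: B_def)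
    then have "rank i M m = rank i M nu"
      using m(2) cnt_LL_rank(1)[OF nz mS(2) pnu] by (simp add: order_antisym)
    then have "m = nu" using cnt_LL_rank(2)[OF nz mS(2) pnu mS(3)] by simp
    with nu show False by simp
  qed
  then have "(\<Sum>nu\<in>S - {m}. c nu * cnt (LL i M (part m)) (part nu)) = 0"
    by (intro sum.neutral) blast
  then have "(\<Sum>nu\<in>S. c nu * cnt (LL i M (part m)) (part nu)) = c m"
    using fin mS cnt_LL_same[OF mS(2,3)] by (simp add: sum.remove[of S m])
  then show False using zero mS by simp
qed

lemma schur_expansion_unique:
  assumes "schur_expansion f c" "schur_expansion f c'"
  shows "c = c'"
proof
  fix mu
  define S where "S = {nu. c nu \<noteq> 0} \<union> {nu. c' nu \<noteq> 0}"
  have fin: "finite S" and S: "\<And>nu. nu \<in> S \<Longrightarrow> is_partition nu"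
    using assms by (auto simp: S_def schur_expansion_def)
  have e: "f alpha = (\<Sum>nu\<in>S. c nu * schur nu alpha)" "f alpha = (\<Sum>nu\<in>S. c' nu * schur nu alpha)" for alpha
  proof -
    have "f alpha = (\<Sum>nu | c nu \<noteq> 0. c nu * schur nu alpha)" using assms by (simp add: schur_expansion_def)
    also have "\<dots> = (\<Sum>nu\<in>S. c nu * schur nu alpha)"
      by (rule sum.mono_neutral_left) (use fin in \<open>auto simp: S_def\<close>)
    finally show "f alpha = (\<Sum>nu\<in>S. c nu * schur nu alpha)" .
    have "f alpha = (\<Sum>nu | c' nu \<noteq> 0. c' nu * schur nu alpha)" using assms by (simp add: schur_expansion_def)
    also have "\<dots> = (\<Sum>nu\<in>S. c' nu * schur nu alpha)"
      by (rule sum.mono_neutral_left) (use fin in \<open>auto simp: S_def\<close>)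
    finally show "f alpha = (\<Sum>nu\<in>S. c' nu * schur nu alpha)" .
  qed
  show "c mu = c' mu"
  proof (cases "mu \<in> S")
    case True
    \<comment> \<open>With this many rows \<open>mu\<close> is fixed by truncation, so triangularity
      applies to the difference of the two expansions.\<close>
    define M where "M = length mu"
    have "(\<Sum>nu\<in>S. (c nu - c' nu) * cnt (LL M M (part m)) (part nu)) = 0" for m
    proof -
      have "(\<Sum>nu\<in>S. (c nu - c' nu) * cnt (LL M M (part m)) (part nu)) =
          (\<Sum>nu\<in>S. c nu * schur nu (tr M M (part m))) - (\<Sum>nu\<in>S. c' nu * schur nu (tr M M (part m)))"
        using S by (simp add: cnt_LL_rows left_diff_distrib sum_subtractf)
      then show ?thesis using e[of "tr M M (part m)"] by simp
    qed
    moreover have "tr M M (part mu) = part mu" by (rule tr_rows) (simp add: M_def part_def)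
    ultimately have "c mu - c' mu = 0"
      using fin S True by (intro triangular_vanishing[of S "\<lambda>nu. c nu - c' nu" M M mu]) auto
    then show ?thesis by simp
  next
    case False
    then show ?thesis by (simp add: S_def)
  qed
qed

section \<open>Existence of Schur expansions\<close>

definition wt :: "(nat \<Rightarrow> nat) \<Rightarrow> nat" where
  "wt alpha = (\<Sum>k | alpha k \<noteq> 0. k * alpha k)"

text \<open>Exchanging an ascent moves the larger exponent to the smaller index; the resulting drop
  in weight makes sorting by adjacent exchanges terminate.\<close>

lemma wt_swp:
  assumes fin: "finite {k. alpha k \<noteq> 0}" and lt: "alpha k < alpha (Suc k)"
  shows "wt (swp k alpha) < wt alpha" and "finite {i. swp k alpha i \<noteq> 0}"
proof -
  define A where "A = {i. alpha i \<noteq> 0} \<union> {k, Suc k}"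
  have A: "finite A" "{k, Suc k} \<subseteq> A" using fin by (auto simp: A_def)
  have sub: "{i. swp k alpha i \<noteq> 0} \<subseteq> A" by (auto simp: A_def swp_def)
  then show "finite {i. swp k alpha i \<noteq> 0}" using A finite_subset by blast
  have w: "wt b = k * b k + Suc k * b (Suc k) + (\<Sum>i\<in>A - {k, Suc k}. i * b i)"
    if "{i. b i \<noteq> 0} \<subseteq> A" for b
  proof -
    have "wt b = (\<Sum>i\<in>A. i * b i)" unfolding wt_def
      by (rule sum.mono_neutral_left) (use A that in auto)
    also have "\<dots> = (\<Sum>i\<in>A - {k, Suc k}. i * b i) + (\<Sum>i\<in>{k, Suc k}. i * b i)"
      using A by (rule sum.subset_diff[rotated])
    finally show ?thesis by simp
  qed
  have "(\<Sum>i\<in>A - {k, Suc k}. i * swp k alpha i) = (\<Sum>i\<in>A - {k, Suc k}. i * alpha i)"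
    by (intro sum.cong) (auto simp: swp_def)
  moreover have vals: "swp k alpha k = alpha (Suc k)" "swp k alpha (Suc k) = alpha k"
    by (simp_all add: swp_def)
  moreover have sub': "{i. alpha i \<noteq> 0} \<subseteq> A" by (auto simp: A_def)
  ultimately show "wt (swp k alpha) < wt alpha"
    using w[OF sub] w[OF sub'] vals lt by simp
qed

text \<open>Sorting the exponents by adjacent exchanges turns any monomial of finite support into
  one indexed by a partition.\<close>

lemma symmetric_zero:
  fixes f :: symfun
  assumes sym: "\<And>alpha k. f (swp k alpha) = f alpha"
    and fin: "\<And>alpha. f alpha \<noteq> 0 \<Longrightarrow> finite {k. alpha k \<noteq> 0}"
    and zero: "\<And>nu. is_partition nu \<Longrightarrow> f (part nu) = 0"
  shows "f alpha = 0"
proof (cases "finite {k. alpha k \<noteq> 0}")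
  case True
  then show ?thesis
  proof (induction "wt alpha" arbitrary: alpha rule: less_induct)
    case less
    show ?case
    proof (cases "antimono alpha")
      case True
      then have "par alpha" using less.prems by (simp add: par_def)
      then show ?thesis using ex_partition zero by blast
    next
      case False
      then obtain k where "alpha k < alpha (Suc k)"
        unfolding antimono_iff_le_Suc by (auto simp: not_le)
      then have "f (swp k alpha) = 0" using wt_swp[OF less.prems] less.hyps by blast
      then show ?thesis using sym by simp
    qed
  qed
next
  case False
  then show ?thesis using fin by blast
qed

text \<open>Elimination from the top rank, \<open>d\<close> bounding the ranks still present:
  subtracting the Schur functions of rank exactly \<open>d\<close>, weighted by the coefficients of
  \<open>f\<close>, clears that rank and by triangularity leaves the higher ones zero.\<close>

lemma symmetric_expansion:
  fixes f :: symfun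
  assumes "\<And>alpha k. f (swp k alpha) = f alpha"
    and "\<And>alpha. f alpha \<noteq> 0 \<Longrightarrow> finite {k. alpha k \<noteq> 0} \<and> psize alpha = N"
    and "\<And>nu. nu \<in> partitions_of N \<Longrightarrow> rank N N nu \<ge> d \<Longrightarrow> f (part nu) = 0"
  shows "\<exists>c. \<forall>alpha. f alpha = (\<Sum>nu\<in>partitions_of N. c nu * schur nu alpha)"
  using assms
proof (induction d arbitrary: f)
  case 0
  have "f (part nu) = 0" if "is_partition nu" for nu
    using 0(2)[of "part nu"] 0(3)[of nu] that by (auto simp: partitions_of_def)
  then have "f alpha = 0" for alpha using symmetric_zero[of f] 0(1,2) by blast
  then show ?case by (intro exI[of _ "\<lambda>_. 0"]) simp
next
  case (Suc d)
  let ?P = "partitions_of N"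
  define a where "a nu = (if rank N N nu = d then f (part nu) else 0)" for nu
  define h where "h alpha = f alpha - (\<Sum>nu\<in>?P. a nu * schur nu alpha)" for alpha
  have P: "is_partition nu" "psize (part nu) = N" if "nu \<in> ?P" for nu
    using that by (auto simp: partitions_of_def)
  have trP: "tr N N (part nu) = part nu" if "nu \<in> ?P" for nu
    using psize_bounds(2)[OF part_par] P[OF that] by (intro tr_rows) simp
  have "\<exists>c. \<forall>alpha. h alpha = (\<Sum>nu\<in>?P. c nu * schur nu alpha)"
  proof (rule Suc.IH)
    fix alpha k
    show "h (swp k alpha) = h alpha"
      unfolding h_def using Suc.prems(1) P schur_swp by simp
  next
    fix alpha assume "h alpha \<noteq> 0"
    then have "f alpha \<noteq> 0 \<or> (\<exists>nu\<in>?P. schur nu alpha \<noteq> 0)"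
      unfolding h_def by (metis (mono_tags, lifting) diff_self mult_zero_right sum.neutral)
    then show "finite {k. alpha k \<noteq> 0} \<and> psize alpha = N"
      using Suc.prems(2) schur_nonzero_finite schur_degree P by metis
  next
    fix mu assume mu: "mu \<in> ?P" and ge: "rank N N mu \<ge> d"
    have s: "schur nu (part mu) = cnt (LL N N (part mu)) (part nu)" if "nu \<in> ?P" for nu
      using cnt_LL_rows[OF P(1)[OF that], of N "part mu"] trP[OF mu] by simp
    have "a nu * schur nu (part mu) = 0" if nu: "nu \<in> ?P - {mu}" for nu
    proof (rule ccontr)
      assume "\<not> ?thesis"
      then have "rank N N nu = d" "cnt (LL N N (part mu)) (part nu) \<noteq> 0"
        using s nu by (auto simp: a_def split: if_splits)
      then have "mu = nu"
        using cnt_LL_rank[of N N mu nu] P mu nu trP[OF mu] ge by auto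
      with nu show False by simp
    qed
    then have "(\<Sum>nu\<in>?P - {mu}. a nu * schur nu (part mu)) = 0"
      by (intro sum.neutral) blast
    then have "(\<Sum>nu\<in>?P. a nu * schur nu (part mu)) = a mu * schur mu (part mu)"
      using finite_partitions_of mu by (simp add: sum.remove[of ?P mu])
    also have "\<dots> = a mu" using s[OF mu] cnt_LL_same[OF P(1) trP] mu by simp
    also have "\<dots> = f (part mu)"
      using ge Suc.prems(3)[OF mu] by (auto simp: a_def)
    finally show "h (part mu) = 0" by (simp add: h_def)
  qed
  then obtain c where "\<And>alpha. h alpha = (\<Sum>nu\<in>?P. c nu * schur nu alpha)" by blast
  then have "f alpha = (\<Sum>nu\<in>?P. (c nu + a nu) * schur nu alpha)" for alpha
    by (simp add: h_def distrib_right sum.distrib diff_eq_eq)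
  then show ?case by (intro exI[of _ "\<lambda>nu. c nu + a nu"]) blast
qed

lemma schur_expansion_exists:
  fixes f :: symfun
  assumes sym: "\<And>alpha k. f (swp k alpha) = f alpha"
    and deg: "\<And>alpha. f alpha \<noteq> 0 \<Longrightarrow> finite {k. alpha k \<noteq> 0} \<and> psize alpha = N"
  shows "\<exists>c. schur_expansion f c"
proof -
  obtain d where d: "\<forall>nu\<in>partitions_of N. rank N N nu < d"
    using finite_nat_set_iff_bounded[of "rank N N ` partitions_of N"] finite_partitions_of by auto
  obtain c where c: "\<And>alpha. f alpha = (\<Sum>nu\<in>partitions_of N. c nu * schur nu alpha)"
    using symmetric_expansion[of f N d, OF sym deg] d by (metis not_le)
  \<comment> \<open>\<open>schur_expansion\<close> asks for finite support consisting of partitions,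
    so the coefficients are set to 0 elsewhere.\<close>
  define c' where "c' nu = (if nu \<in> partitions_of N then c nu else 0)" for nu
  have sub: "{nu. c' nu \<noteq> 0} \<subseteq> partitions_of N" by (auto simp: c'_def)
  have "f alpha = (\<Sum>nu | c' nu \<noteq> 0. c' nu * schur nu alpha)" for alpha
  proof -
    have "f alpha = (\<Sum>nu\<in>partitions_of N. c' nu * schur nu alpha)"
      unfolding c by (intro sum.cong) (auto simp: c'_def)
    also have "\<dots> = (\<Sum>nu | c' nu \<noteq> 0. c' nu * schur nu alpha)"
      using sub finite_partitions_of by (intro sum.mono_neutral_right) auto
    finally show ?thesis .
  qed
  moreover have "finite {nu. c' nu \<noteq> 0}" using sub finite_partitions_of finite_subset by blast
  moreover have "c' nu \<noteq> 0 \<Longrightarrow> is_partition nu" for nu using sub by (auto simp: partitions_of_def)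
  ultimately show ?thesis unfolding schur_expansion_def by blast
qed

section \<open>Pairing with products of complete and elementary functions\<close>

text \<open>For symmetric \<open>f\<close>, \<open>Lf f [a\<^sub>1, \<dots>] [w\<^sub>1, \<dots>]\<close> is the Hall pairing of \<open>f\<close> with
  \<open>h\<^bsub>w\<^sub>1\<^esub> h\<^bsub>w\<^sub>2\<^esub> \<dots> e\<^bsub>a\<^sub>1\<^esub> e\<^bsub>a\<^sub>2\<^esub> \<dots>\<close>; the recursion
  \<open>e\<^sub>k = \<Sum> (-1)\<^bsup>a-1\<^esup> h\<^sub>a e\<^bsub>k-a\<^esub>\<close> reduces it to coefficients of \<open>f\<close>.\<close>

function Lf :: "symfun \<Rightarrow> nat list \<Rightarrow> nat list \<Rightarrow> int" where
  "Lf f [] w = f (part w)"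
| "Lf f (0 # as) w = Lf f as w"
| "Lf f (Suc k # as) w = (\<Sum>a=1..Suc k. (-1) ^ (a - 1) * Lf f ((Suc k - a) # as) (w @ [a]))"
  by pat_completeness auto
termination
  by (relation "measure (\<lambda>(f, as, w). sum_list as + length as)") auto

text \<open>Strip counts obey the recursion of \<open>Lf\<close> by \<open>cnt_e_expansion\<close>.
  The lists are reversed because \<open>cnt\<close> reads the outermost strip first, which puts the
  vertical letter being expanded next to the horizontal ones.\<close>

lemma Lf_schur:
  assumes "is_partition nu"
  shows "Lf (schur nu) as w = cnt (map (Pair True) (rev as) @ map (Pair False) (rev w)) (part nu)"
proof (induction "schur nu" as w rule: Lf.induct)
  case (1 w)
  have "map (\<lambda>k. (False, part w k)) [0..<length w] = map (Pair False) w"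
    by (rule nth_equalityI) (auto simp: part_def)
  moreover have "\<forall>k\<ge>length w. part w k = 0" by (simp add: part_def)
  ultimately show ?case using schur_cnt[OF assms, of "length w" "part w"] by (simp flip: rev_map)
next
  case (2 as w)
  then show ?case using cnt_zero_letter[OF part_par[OF assms], of "map (Pair True) (rev as)" True] by simp
next
  case (3 k as w)
  have "Lf (schur nu) (Suc k # as) w = (\<Sum>a=1..Suc k. (-1) ^ (a - 1) *
      cnt (map (Pair True) (rev as) @ (True, Suc k - a) # (False, a) # map (Pair False) (rev w)) (part nu))"
    unfolding Lf.simps by (intro sum.cong refl) (subst 3, auto)
  then show ?case using cnt_e_expansion[OF part_par[OF assms]] by simp
qed

lemma Lf_sum:
  "Lf (\<lambda>alpha. \<Sum>nu\<in>S. c nu * g nu alpha) as w = (\<Sum>nu\<in>S. c nu * Lf (g nu) as w)"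
proof (induction "\<lambda>alpha. \<Sum>nu\<in>S. c nu * g nu alpha" as w rule: Lf.induct)
  case (3 k as w)
  have "Lf (\<lambda>alpha. \<Sum>nu\<in>S. c nu * g nu alpha) (Suc k # as) w =
      (\<Sum>a=1..Suc k. \<Sum>nu\<in>S. c nu * ((-1) ^ (a - 1) * Lf (g nu) ((Suc k - a) # as) (w @ [a])))"
    unfolding Lf.simps by (intro sum.cong refl) (subst 3, auto simp: sum_distrib_left mult.left_commute)
  also have "\<dots> = (\<Sum>nu\<in>S. c nu * Lf (g nu) (Suc k # as) w)"
    by (subst sum.swap) (simp only: Lf.simps sum_distrib_left)
  finally show ?case .
qed auto

lemma part_div:
  "(\<forall>k. n dvd part w k) \<longleftrightarrow> (\<forall>a\<in>set w. n dvd a)"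
  "(\<lambda>k. part w k div n) = part (map (\<lambda>a. a div n) w)"
  by (auto simp: part_def all_set_conv_all_nth)

text \<open>The adjoint of \<open>p\<^sub>n \<circ> _\<close> is the ring homomorphism with \<open>h\<^sub>k \<mapsto> h\<^bsub>k/n\<^esub>\<close> and
  \<open>e\<^sub>k \<mapsto> \<plusminus>e\<^bsub>k/n\<^esub>\<close>, where a fractional index means \<open>0\<close>.\<close>

lemma Lf_pleth:
  assumes n: "n > 0"
  shows "Lf (pleth_pn_schur n lam) as w =
    (if (\<forall>a\<in>set as \<union> set w. n dvd a)
     then (-1) ^ (sum_list as + sum_list (map (\<lambda>a. a div n) as)) *
       Lf (schur lam) (map (\<lambda>a. a div n) as) (map (\<lambda>a. a div n) w)
     else 0)"
proof (induction "pleth_pn_schur n lam" as w rule: Lf.induct)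
  case (1 w)
  then show ?case by (simp add: pleth_pn_schur_def part_div)
next
  case (2 as w)
  then show ?case by simp
next
  case (3 k as w)
  let ?d = "\<lambda>a. a div n"
  define G where "G a = (-1) ^ (a - 1) * Lf (pleth_pn_schur n lam) ((Suc k - a) # as) (w @ [a])" for a
  have lhs: "Lf (pleth_pn_schur n lam) (Suc k # as) w = sum G {1..Suc k}"
    unfolding G_def by simp
  have G0: "G a = 0" if "a \<in> {1..Suc k}" "\<not> (n dvd a \<and> n dvd (Suc k - a) \<and> (\<forall>a\<in>set as \<union> set w. n dvd a))" for a
    unfolding G_def using 3[OF that(1)] that(2) by auto
  show ?case
  proof (cases "\<forall>a\<in>set (Suc k # as) \<union> set w. n dvd a")
    case False
    have "G a = 0" if "a \<in> {1..Suc k}" for a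
    proof (rule G0[OF that])
      show "\<not> (n dvd a \<and> n dvd (Suc k - a) \<and> (\<forall>a\<in>set as \<union> set w. n dvd a))"
      proof
        \<comment> \<open>A nonzero term would make \<open>n\<close> divide \<open>a\<close> and
          \<open>Suc k - a\<close>, hence \<open>Suc k\<close>, contrary to the case
          assumption.\<close>
        assume *: "n dvd a \<and> n dvd (Suc k - a) \<and> (\<forall>a\<in>set as \<union> set w. n dvd a)"
        then have "n dvd (Suc k - a) + a" by (intro dvd_add) auto
        then have "n dvd Suc k" using that by simp
        with * False show False by auto
      qed
    qed
    then have "sum G {1..Suc k} = 0" by (intro sum.neutral) blast
    then show ?thesis unfolding lhs using False by (simp only: if_False)
  next
    case True
    then obtain q where q: "Suc k = n * q" by (auto elim: dvdE)
    then obtain q' where q': "q = Suc q'" using n by (cases q) auto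
    define e where "e = sum_list as + sum_list (map ?d as)"
    \<comment> \<open>Only multiples \<open>a = n * b\<close> contribute, which turns the recursion
      for \<open>Suc k = n * q\<close> into the one for \<open>q\<close>.\<close>
    have "sum G {1..Suc k} = sum G ((\<lambda>b. n * b) ` {1..q})"
    proof (rule sum.mono_neutral_right)
      show "(\<lambda>b. n * b) ` {1..q} \<subseteq> {1..Suc k}" using n unfolding q by auto
      show "\<forall>a\<in>{1..Suc k} - (\<lambda>b. n * b) ` {1..q}. G a = 0"
      proof
        fix a assume a: "a \<in> {1..Suc k} - (\<lambda>b. n * b) ` {1..q}"
        have "\<not> n dvd a"
        proof
          assume "n dvd a"
          then obtain b where b: "a = n * b" by (elim dvdE)
          have "n * b \<le> n * q" "b \<noteq> 0" using a unfolding b q by auto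
          then have "b \<in> {1..q}" using n by (simp add: Suc_le_eq)
          then show False using a b by blast
        qed
        then show "G a = 0" using G0 a by blast
      qed
    qed simp
    also have "\<dots> = (\<Sum>b=1..q. G (n * b))"
      using n by (subst sum.reindex) (auto simp: inj_on_def)
    also have "\<dots> = (\<Sum>b=1..q. (-1) ^ (n * q + q + e) *
        ((-1) ^ (b - 1) * Lf (schur lam) ((q - b) # map ?d as) (map ?d w @ [b])))"
    proof (rule sum.cong[OF refl])
      fix b assume b: "b \<in> {1..q}"
      then have nb: "n * b \<in> {1..Suc k}" using n unfolding q by auto
      have diff: "Suc k - n * b = n * (q - b)" unfolding q by (simp add: diff_mult_distrib2)
      have "Lf (pleth_pn_schur n lam) ((Suc k - n * b) # as) (w @ [n * b]) =
          (-1) ^ (n * (q - b) + (q - b) + e) * Lf (schur lam) ((q - b) # map ?d as) (map ?d w @ [b])"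
        using 3[OF nb] True n unfolding diff by (simp add: e_def ac_simps)
      \<comment> \<open>Both exponents have the same parity. The first sign on the right does not
        depend on \<open>b\<close>, and the second is the one in the recursion for \<open>q\<close>,
        so the sum folds back into \<open>Lf\<close>.\<close>
      moreover have "(-1) ^ (n * b - 1) * (-1::int) ^ (n * (q - b) + (q - b) + e) =
          (-1) ^ (n * q + q + e) * (-1) ^ (b - 1)"
      proof -
        obtain c where c: "q = b + c" using b le_Suc_ex by auto
        obtain b' where b': "b = Suc b'" using b by (cases b) auto
        have "n * b - 1 = n * b' + (n - 1)" using n b' by simp
        moreover have "even (n * b' + (n - 1) + (n * c + c + e) + (n * (b + c) + (b + c) + e + b'))"
          using n b' by (cases n) auto
        ultimately show ?thesis
          unfolding power_add[symmetric] using c b' by (simp add: minus_one_power_iff)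
      qed
      ultimately show "G (n * b) = (-1) ^ (n * q + q + e) *
        ((-1) ^ (b - 1) * Lf (schur lam) ((q - b) # map ?d as) (map ?d w @ [b]))"
        unfolding G_def by (simp only: mult.assoc[symmetric])
    qed
    also have "\<dots> = (-1) ^ (n * q + q + e) * Lf (schur lam) (q # map ?d as) (map ?d w)"
      unfolding q' Lf.simps sum_distrib_left ..
    finally show ?thesis unfolding lhs using True n q
      by (simp add: e_def ac_simps)
  qed
qed

section \<open>Schur coefficients of the plethysm\<close>

lemma pleth_expansion_exists:
  assumes n: "n > 0" and lam: "is_partition lam"
  shows "\<exists>c. schur_expansion (pleth_pn_schur n lam) c"
proof (rule schur_expansion_exists)
  fix alpha k
  have "\<forall>i. n dvd swp k b i" if "\<forall>i. n dvd b i" for b using that by (simp add: swp_def)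
  from this[of alpha] this[of "swp k alpha"]
  have "(\<forall>i. n dvd swp k alpha i) \<longleftrightarrow> (\<forall>i. n dvd alpha i)" by (auto simp: swp_swp)
  moreover have "(\<lambda>i. swp k alpha i div n) = swp k (\<lambda>i. alpha i div n)"
    by (auto simp: swp_def fun_eq_iff)
  ultimately show "pleth_pn_schur n lam (swp k alpha) = pleth_pn_schur n lam alpha"
    using schur_swp[OF lam] by (simp add: pleth_pn_schur_def)
next
  fix alpha assume "pleth_pn_schur n lam alpha \<noteq> 0"
  then have dvd: "\<And>i. n dvd alpha i" and nz: "schur lam (\<lambda>k. alpha k div n) \<noteq> 0"
    by (auto simp: pleth_pn_schur_def split: if_splits)
  have supp: "{k. alpha k div n \<noteq> 0} = {k. alpha k \<noteq> 0}"
    using dvd by (auto simp: dvd_div_eq_0_iff)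
  have "psize alpha = (\<Sum>k | alpha k \<noteq> 0. n * (alpha k div n))" using dvd by (simp add: psize_def)
  also have "\<dots> = n * psize (\<lambda>k. alpha k div n)" unfolding psize_def supp by (simp add: sum_distrib_left)
  finally show "finite {k. alpha k \<noteq> 0} \<and> psize alpha = n * psize (part lam)"
    using schur_nonzero_finite[OF lam nz] schur_degree[OF lam nz] supp by simp
qed

lemma hall_schur_eq: "schur_expansion f c \<Longrightarrow> hall_schur mu f = c mu"
  unfolding hall_schur_def using schur_expansion_unique by (metis the_equality)

theorem mainTheorem3:
  fixes n :: nat and lam mu :: "nat list"
  assumes "n > 0" and "is_partition lam" and "is_partition mu"
    and "hall_schur mu (pleth_pn_schur n lam) \<noteq> 0"
  shows "diagram lam \<subseteq> diagram mu"
proof (rule ccontr)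
  assume "\<not> ?thesis"
  then obtain b where "b \<in> diagram lam" "b \<notin> diagram mu" by blast
  then obtain i j where ji: "j < part lam i" "part mu i \<le> j"
    by (cases b) (auto simp: diagram_def not_less)
  obtain c where c: "schur_expansion (pleth_pn_schur n lam) c"
    using pleth_expansion_exists assms(1,2) by blast
  define S where "S = {nu. c nu \<noteq> 0}"
  have S: "finite S" "\<And>nu. nu \<in> S \<Longrightarrow> is_partition nu"
    and f: "pleth_pn_schur n lam = (\<lambda>alpha. \<Sum>nu\<in>S. c nu * schur nu alpha)"
    using c by (auto simp: S_def schur_expansion_def)
  \<comment> \<open>The first \<open>i\<close> sizes become horizontal letters and the next
    \<open>j\<close> vertical ones, which is the pattern of \<open>LL i (i + j)\<close>.\<close>
  have letters: "map (Pair True) (rev (map g [i..<i + j])) @ map (Pair False) (rev (map g [0..<i])) =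
      map (\<lambda>k. (i \<le> k, g k)) (rev [0..<i + j])" for g :: "nat \<Rightarrow> nat"
    using upt_add_eq_append[of 0 i j] by (simp add: rev_map)
  have zero: "(\<Sum>nu\<in>S. c nu * cnt (LL i (i + j) (part m)) (part nu)) = 0" for m
  proof -
    define g where "g k = psize (tr i (Suc k) (part m)) - psize (tr i k (part m))" for k
    let ?as = "map g [i..<i + j]" and ?w = "map g [0..<i]"
    have LL: "LL i (i + j) (part m) = map (Pair True) (rev ?as) @ map (Pair False) (rev ?w)"
      unfolding letters by (simp add: LL_def g_def)
    \<comment> \<open>Box \<open>(j, i)\<close> of \<open>lam\<close> lies outside the hook of the
      first \<open>i\<close> rows and \<open>j\<close> columns, so no strip sizes, in particular not
      \<open>g k div n\<close>, can build \<open>lam\<close>.\<close>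
    have "tr i (i + j) (part lam) i = j" using ji by (simp add: tr_def)
    then have "tr i (i + j) (part lam) \<noteq> part lam" using ji by (metis less_irrefl)
    then have "cnt (map (\<lambda>k. (i \<le> k, g k div n)) (rev [0..<i + j])) (part lam) = 0"
      using cnt_tr[OF _ part_par[OF assms(2)], of i "\<lambda>k. g k div n" "i + j"] by blast
    then have "Lf (schur lam) (map (\<lambda>a. a div n) ?as) (map (\<lambda>a. a div n) ?w) = 0"
      using letters[of "\<lambda>k. g k div n"] by (simp add: Lf_schur[OF assms(2)] o_def)
    then have "Lf (pleth_pn_schur n lam) ?as ?w = 0"
      unfolding Lf_pleth[OF assms(1)] by simp
    then show ?thesis
      unfolding f Lf_sum LL using S(2) by (simp add: Lf_schur)
  qed
  have "hall_schur mu (pleth_pn_schur n lam) = c mu" using hall_schur_eq[OF c] .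
  then have mu: "mu \<in> S" "c mu \<noteq> 0" using assms(4) by (auto simp: S_def)
  \<comment> \<open>Without box \<open>(j, i)\<close> all rows of \<open>mu\<close> from
    \<open>i\<close> on have length at most \<open>j\<close>, so \<open>mu\<close> fits into the
    hook and its coefficient is forced to vanish.\<close>
  have "tr i (i + j) (part mu) r = part mu r" for r
  proof (cases "r < i")
    case False
    then have "part mu r \<le> part mu i" using par_decr[OF part_par[OF assms(3)], of i r] by simp
    then show ?thesis using ji False by (simp add: tr_def)
  qed (simp add: tr_def)
  then have trmu: "tr i (i + j) (part mu) = part mu" by (rule ext)
  have "c mu = 0"
    by (rule triangular_vanishing[of S c i "i + j"]) (use S zero mu(1) trmu in auto)
  with mu show False by simp
qed

end
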